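(* Let $L$ be a finite set of integers, each at least $3$, containing at least one even integer. Let $2\ell$ be the smallest even element of $L$ and $k$ the largest element of $L$. Then \[c(L,n)=\Theta_L\!\left(n^{\lfloor k/\ell\rfloor}\right),\] i.e., there are constants $C_1,C_2>0$ and $n_0$ depending only on $L$ such that $C_1 n^{\lfloor k/\ell\rfloor}\le c(L,n)\le C_2 n^{\lfloor k/\ell\rfloor}$ for all $n\ge n_0$.
   Context: Graphs are finite, simple and undirected. For a set $L$ of positive integers, a graph $G$ is an $L$-cycle graph if the length (number of edges) of every cycle of $G$ belongs to $L$. $c(L,n)$ denotes the maximum number of cycles in an $n$-vertex $L$-cycle graph. *)

theory Defs
  imports Complex_Main
begin

definition simple_graph :: "'a set \<Rightarrow> 'a set set \<Rightarrow> bool" where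
  "simple_graph V E \<longleftrightarrow> finite V \<and> (\<forall>e\<in>E. e \<subseteq> V \<and> card e = 2)"

text \<open>The edges traversed by the closed walk through \<open>vs\<close>, returning from the last vertex
  to the first.\<close>

definition closed_walk_edges :: "'a list \<Rightarrow> 'a set set" where
  "closed_walk_edges vs = (\<lambda>i. {vs ! i, vs ! (Suc i mod length vs)}) ` {..<length vs}"

text \<open>A cycle is a subgraph, not a vertex sequence: it is represented by its edge set, so that
  the choices of starting point and orientation are not counted separately. Its length is
  therefore its cardinality.\<close>

definition cycles :: "'a set set \<Rightarrow> 'a set set set" where
  "cycles E = {closed_walk_edges vs | vs.
     3 \<le> length vs \<and> distinct vs \<and> closed_walk_edges vs \<subseteq> E}"

definition L_cycle_graph :: "nat set \<Rightarrow> 'a set \<Rightarrow> 'a set set \<Rightarrow> bool" where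
  "L_cycle_graph L V E \<longleftrightarrow> simple_graph V E \<and> (\<forall>C\<in>cycles E. card C \<in> L)"

text \<open>Up to isomorphism, every \<open>n\<close>-vertex graph has vertex set \<open>{..<n}\<close>.\<close>

definition max_cycles :: "nat set \<Rightarrow> nat \<Rightarrow> nat" where
  "max_cycles L n = Max {card (cycles E) | E. L_cycle_graph L {..<n} E}"

text \<open>The maximum ranges over a finite nonempty set, and \<open>card\<close> is applied to finite sets only.\<close>

lemma card_closed_walk_edges:
  assumes "3 \<le> length vs" "distinct vs"
  shows "card (closed_walk_edges vs) = length vs"
proof -
  let ?n = "length vs"
  have "inj_on (\<lambda>i. {vs ! i, vs ! (Suc i mod ?n)}) {..<?n}"
  proof (rule inj_onI)
    fix i j
    assume ij: "i \<in> {..<?n}" "j \<in> {..<?n}"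
      and eq: "{vs ! i, vs ! (Suc i mod ?n)} = {vs ! j, vs ! (Suc j mod ?n)}"
    have lt: "Suc i mod ?n < ?n" "Suc j mod ?n < ?n"
      using assms(1) by (auto intro!: mod_less_divisor)
    have nth: "vs ! a = vs ! b \<longleftrightarrow> a = b" if "a < ?n" "b < ?n" for a b
      using that assms(2) by (simp add: nth_eq_iff_index_eq)
    show "i = j"
    proof (rule ccontr)
      assume ne: "i \<noteq> j"
      have "vs ! i = vs ! (Suc j mod ?n)" "vs ! (Suc i mod ?n) = vs ! j"
        using eq ne ij nth by (auto simp: doubleton_eq_iff)
      hence "i = Suc j mod ?n" "Suc i mod ?n = j" using ij lt nth by auto
      thus False using ij assms(1) by (auto simp: mod_Suc split: if_splits)
    qed
  qed
  thus ?thesis by (simp add: closed_walk_edges_def card_image)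
qed

lemma finite_edges: "simple_graph V E \<Longrightarrow> finite E"
  by (rule finite_subset[of _ "Pow V"]) (auto simp: simple_graph_def)

lemma finite_cycles: "finite E \<Longrightarrow> finite (cycles E)"
  by (rule finite_subset[of _ "Pow E"]) (auto simp: cycles_def)

lemma cycles_empty: "cycles {} = {}"
  by (force simp: cycles_def closed_walk_edges_def lessThan_empty_iff)

lemma max_cycles_range_finite:
  fixes n :: nat
  shows "finite {card (cycles E) | E. L_cycle_graph L {..<n} E}"
proof -
  have "{E. L_cycle_graph L {..<n} E} \<subseteq> Pow (Pow {..<n})"
    by (auto simp: L_cycle_graph_def simple_graph_def)
  hence "finite {E. L_cycle_graph L {..<n} E}" by (rule finite_subset) simp
  thus ?thesis by simp
qed

lemma max_cycles_range_nonempty: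
  fixes n :: nat
  shows "{card (cycles E) | E. L_cycle_graph L {..<n} E} \<noteq> {}"
proof -
  have "L_cycle_graph L {..<n} ({} :: nat set set)"
    by (simp add: L_cycle_graph_def simple_graph_def cycles_empty)
  thus ?thesis by blast
qed

end

theory Submission
  imports Defs "HOL-Library.FuncSet"
begin

text \<open>Lower bound: blow up \<open>k div l\<close> consecutive segments of length \<open>l\<close> of a \<open>k\<close>-cycle into parallel
  paths. Cycles then have length \<open>2 * l\<close> or \<open>k\<close>, and there is one \<open>k\<close>-cycle for each choice of one
  path per segment.

  Upper bound: if there are too many cycles of length \<open>m\<close>, a homogeneous nonempty subfamily remains
  in which every set of at most \<open>k div l\<close> positions lies in a proper set \<open>J\<close> of positions such
  that each cycle of the subfamily can be replaced by one agreeing with it on \<open>J\<close> and otherwise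
  avoiding any given bounded set of vertices. A gap of such a \<open>J\<close> is an arc. Replacing the interior
  of an arc of length \<open>s\<close> gives a cycle of length \<open>2 * s\<close>, so that \<open>s \<ge> l\<close>. Two arcs cannot
  cross, since otherwise there would be arbitrarily long cycles. Hence some \<open>k div l\<close> positions hit
  the interiors of all arcs, which contradicts the choice of the subfamily.\<close>

subsection \<open>Cyclic parametrizations\<close>

text \<open>Positions are all integers, not residues, so that reversals, shifts and arcs across 0
  need no case distinction. The equivalence gives both the period \<open>m\<close> and injectivity
  on every window of \<open>m\<close> positions.\<close>

definition cyclic_param :: "'a set set \<Rightarrow> int \<Rightarrow> (int \<Rightarrow> 'a) \<Rightarrow> bool" where
  "cyclic_param E m f \<longleftrightarrow>
     (\<forall>i. {f i, f (i + 1)} \<in> E) \<and> (\<forall>i j. f i = f j \<longleftrightarrow> i mod m = j mod m)"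

lemma cyclic_param_edge: "cyclic_param E m f \<Longrightarrow> {f i, f (i + 1)} \<in> E"
  by (simp add: cyclic_param_def)

lemma cyclic_param_eq_iff: "cyclic_param E m f \<Longrightarrow> f i = f j \<longleftrightarrow> i mod m = j mod m"
  by (simp add: cyclic_param_def)

lemma cyclic_param_mod: "cyclic_param E m f \<Longrightarrow> f (i mod m) = f i"
  by (simp add: cyclic_param_eq_iff)

lemma cyclic_param_period: "cyclic_param E m f \<Longrightarrow> f (i + m) = f i"
  by (simp add: cyclic_param_eq_iff)

lemma mod_eq_int_window:
  fixes i j m :: int
  assumes "i mod m = j mod m" "\<bar>i - j\<bar> < m"
  shows "i = j"
proof -
  have "m dvd i - j" using assms(1) by (simp add: mod_eq_dvd_iff)
  thus ?thesis using assms(2) zdvd_imp_le[of m "\<bar>i - j\<bar>"] by auto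
qed

lemma cyclic_param_eqD:
  "cyclic_param E m f \<Longrightarrow> f i = f j \<Longrightarrow> \<bar>i - j\<bar> < m \<Longrightarrow> i = j"
  by (rule mod_eq_int_window[of _ m]) (simp_all add: cyclic_param_eq_iff)

text \<open>The vertex list is repeated periodically in both directions. The last equation recovers
  the cycle from \<open>f\<close>, so that cycles can be counted through their
  parametrizations.\<close>

lemma cycles_cyclic_param:
  assumes "C \<in> cycles E"
  obtains f where "cyclic_param E (int (card C)) f" "3 \<le> card C"
    "C = (\<lambda>i. {f i, f (i + 1)}) ` {0..<int (card C)}"
proof -
  obtain vs where vs: "C = closed_walk_edges vs" "3 \<le> length vs" "distinct vs"
    "closed_walk_edges vs \<subseteq> E"
    using assms by (auto simp: cycles_def)
  let ?m = "length vs"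
  have card: "card C = ?m" using vs card_closed_walk_edges by blast
  define f where "f i = vs ! nat (i mod int ?m)" for i
  have step: "{f i, f (i + 1)} = {vs ! j, vs ! (Suc j mod ?m)}" if "j = nat (i mod int ?m)" for i j
  proof -
    have "0 < int ?m" using vs(2) by linarith
    hence "int j = i mod int ?m" using that by simp
    hence "int (Suc j mod ?m) = (i + 1) mod int ?m"
      by (simp add: zmod_int add.commute mod_add_right_eq)
    hence "nat ((i + 1) mod int ?m) = Suc j mod ?m" by linarith
    thus ?thesis using that by (simp add: f_def)
  qed
  have lt: "nat (i mod int ?m) < ?m" for i
  proof -
    have "0 < int ?m" using vs(2) by linarith
    thus ?thesis by (simp add: nat_less_iff)
  qed
  have "{f i, f (i + 1)} \<in> E" for i
    using step[OF refl, of i] lt[of i] vs(4) by (auto simp: closed_walk_edges_def)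
  moreover have "f i = f j \<longleftrightarrow> i mod int ?m = j mod int ?m" for i j
  proof -
    have "f i = f j \<longleftrightarrow> nat (i mod int ?m) = nat (j mod int ?m)"
      unfolding f_def by (rule nth_eq_iff_index_eq[OF vs(3) lt lt])
    also have "\<dots> \<longleftrightarrow> i mod int ?m = j mod int ?m"
      using vs(2) by (intro eq_nat_nat_iff pos_mod_sign) linarith+
    finally show ?thesis .
  qed
  ultimately have "cyclic_param E (int (card C)) f" by (simp add: cyclic_param_def card)
  moreover have "C = (\<lambda>i. {f i, f (i + 1)}) ` {0..<int (card C)}"
  proof -
    have "C = (\<lambda>j. {f (int j), f (int j + 1)}) ` {..<?m}"
      unfolding vs(1) closed_walk_edges_def
      by (intro image_cong refl) (rule step[symmetric], simp)
    also have "\<dots> = (\<lambda>i. {f i, f (i + 1)}) ` int ` {..<?m}" by (simp add: image_image)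
    also have "int ` {..<?m} = {0..<int ?m}"
      by (simp add: image_int_atLeastLessThan lessThan_atLeast0)
    finally show ?thesis unfolding card .
  qed
  ultimately show thesis using that vs(2) card by simp
qed

lemma cycles_listI:
  assumes "distinct p" "3 \<le> length p" "successively (\<lambda>x y. {x, y} \<in> E) p" "{last p, hd p} \<in> E"
  shows "closed_walk_edges p \<in> cycles E" "card (closed_walk_edges p) = length p"
proof -
  have "{p ! i, p ! (Suc i mod length p)} \<in> E" if "i < length p" for i
  proof (cases "Suc i = length p")
    case True
    hence "p ! i = last p" using last_conv_nth[of p] by (metis diff_Suc_1 list.size(3) nat.simps(3))
    moreover have "p ! 0 = hd p" using that by (cases p) auto
    ultimately show ?thesis using True assms(4) by simp
  next
    case False
    thus ?thesis using that assms(3) by (simp add: successively_conv_nth)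
  qed
  thus "closed_walk_edges p \<in> cycles E" using assms by (auto simp: cycles_def closed_walk_edges_def)
  show "card (closed_walk_edges p) = length p" using assms card_closed_walk_edges by blast
qed

subsection \<open>Homogeneous subfamilies\<close>

definition determines :: "('i \<Rightarrow> 'a) set \<Rightarrow> 'i set \<Rightarrow> 'i \<Rightarrow> bool" where
  "determines F J i \<longleftrightarrow> (\<forall>f\<in>F. \<forall>g\<in>F. (\<forall>j\<in>J. f j = g j) \<longrightarrow> f i = g i)"

text \<open>The image of \<open>{..<N}\<close> under \<open>e\<close> stands for an arbitrary set of
  at most \<open>N\<close> forbidden values.\<close>

definition rich :: "nat \<Rightarrow> 'i set \<Rightarrow> ('i \<Rightarrow> 'a) set \<Rightarrow> 'i set \<Rightarrow> ('i \<Rightarrow> 'a) \<Rightarrow> bool" where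
  "rich N I F J f \<longleftrightarrow>
     (\<forall>e::nat \<Rightarrow> 'a. \<exists>g\<in>F. (\<forall>j\<in>J. g j = f j) \<and> (\<forall>i\<in>I - J. g i \<notin> e ` {..<N}))"

lemma richD:
  assumes "rich N I F J f" "finite W" "card W \<le> N"
  obtains g where "g \<in> F" "\<And>j. j \<in> J \<Longrightarrow> g j = f j" "\<And>i. i \<in> I - J \<Longrightarrow> g i \<notin> W"
proof -
  obtain e where "bij_betw e {..<card W} W"
    using ex_bij_betw_nat_finite[OF assms(2)] by (auto simp: lessThan_atLeast0)
  hence "W \<subseteq> e ` {..<N}" using assms(3) by (force simp: bij_betw_def)
  moreover obtain g where "g \<in> F" "\<forall>j\<in>J. g j = f j" "\<forall>i\<in>I - J. g i \<notin> e ` {..<N}"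
    using assms(1) unfolding rich_def by meson
  ultimately show thesis using that[of g] by (meson in_mono)
qed

text \<open>While some \<open>f\<close> is not rich for some \<open>J\<close>, the whole class of
  members agreeing with \<open>f\<close> on \<open>J\<close> is moved to \<open>D J\<close>.\<close>

lemma rich_cleaning:
  fixes F :: "('i \<Rightarrow> 'a) set"
  assumes "finite F"
  shows "\<exists>X D. X \<subseteq> F \<and> F = X \<union> (\<Union>J\<in>\<J>. D J) \<and> (\<forall>J\<in>\<J>. \<forall>f\<in>X. rich N I X J f) \<and>
    (\<forall>J\<in>\<J>. \<forall>f\<in>D J. \<not> rich N I (D J) J f)"
  using assms
proof (induction rule: finite_psubset_induct)
  case (psubset F)
  show ?case
  proof (cases "\<forall>J\<in>\<J>. \<forall>f\<in>F. rich N I F J f")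
    case True
    thus ?thesis by (intro exI[of _ F] exI[of _ "\<lambda>_. {}"]) auto
  next
    case False
    then obtain J f where J: "J \<in> \<J>" "f \<in> F" "\<not> rich N I F J f" by blast
    define P where "P = {g\<in>F. \<forall>j\<in>J. g j = f j}"
    have "F - P \<subset> F" using J by (auto simp: P_def)
    from psubset.IH[OF this] obtain X D where XD: "X \<subseteq> F - P" "F - P = X \<union> (\<Union>J\<in>\<J>. D J)"
      "\<forall>J\<in>\<J>. \<forall>f\<in>X. rich N I X J f" "\<forall>J\<in>\<J>. \<forall>f\<in>D J. \<not> rich N I (D J) J f"
      by blast
    define D' where "D' = D(J := D J \<union> P)"
    have DJ: "D J \<subseteq> F - P" using XD(2) J(1) by blast
    \<comment> \<open>A member of \<open>P\<close> keeps the obstruction of \<open>f\<close>, since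
      \<open>D J\<close> and \<open>P\<close> lie in \<open>F\<close>. A member of
      \<open>D J\<close> agrees on \<open>J\<close> with no member of \<open>P\<close>, so the added
      class offers it no replacement.\<close>
    have "\<not> rich N I (D J \<union> P) J h" if "h \<in> D J \<union> P" for h
    proof (cases "h \<in> P")
      case True
      have "D J \<union> P \<subseteq> F" using DJ by (auto simp: P_def)
      moreover have "(\<forall>j\<in>J. g j = h j) = (\<forall>j\<in>J. g j = f j)" for g
        using True by (simp add: P_def)
      ultimately show ?thesis using J(3) unfolding rich_def by (metis subsetD)
    next
      case False
      hence h: "h \<in> D J" "h \<in> F - P" using that DJ by auto
      have "\<not> (\<forall>j\<in>J. g j = h j)" if "g \<in> P" for g
        using that h(2) unfolding P_def by fastforce
      moreover have "\<not> rich N I (D J) J h" using XD(4) J(1) h by blast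
      ultimately show ?thesis unfolding rich_def by blast
    qed
    hence "\<forall>J\<in>\<J>. \<forall>f\<in>D' J. \<not> rich N I (D' J) J f" using XD(4) by (auto simp: D'_def)
    moreover have "F = X \<union> (\<Union>J\<in>\<J>. D' J)"
    proof -
      have "(\<Union>J\<in>\<J>. D' J) = (\<Union>J\<in>\<J>. D J) \<union> P" using J(1) by (auto simp: D'_def split: if_splits)
      moreover have "F = (F - P) \<union> P" by (auto simp: P_def)
      ultimately show ?thesis using XD(2) by (metis Un_assoc)
    qed
    moreover have "X \<subseteq> F" using XD(1) by blast
    ultimately show ?thesis using XD(3) by (intro exI[of _ X] exI[of _ D']) simp
  qed
qed

lemma card_pigeonhole_cover:
  assumes "finite P" "F \<noteq> {}" "F \<subseteq> (\<Union>x\<in>P. A x)" "\<And>x. x \<in> P \<Longrightarrow> finite (A x)"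
  shows "\<exists>x\<in>P. card F \<le> card P * card (A x)"
proof -
  let ?M = "Max ((\<lambda>x. card (A x)) ` P)"
  have "P \<noteq> {}" using assms(2,3) by auto
  hence "?M \<in> (\<lambda>x. card (A x)) ` P" using assms(1) by (intro Max_in) auto
  then obtain x where x: "x \<in> P" "?M = card (A x)" by blast
  have "card F \<le> card (\<Union>x\<in>P. A x)" using assms by (intro card_mono) auto
  also have "\<dots> \<le> (\<Sum>y\<in>P. card (A y))" by (rule card_UN_le[OF assms(1)])
  also have "\<dots> \<le> (\<Sum>y\<in>P. card (A x))"
    using assms(1) by (intro sum_mono) (simp flip: x(2))
  finally show ?thesis using x(1) by auto
qed

text \<open>For each restriction to \<open>J\<close> there are \<open>N\<close> values such that
  every member with this restriction takes one of them outside \<open>J\<close>. Pigeonhole on the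
  position and the index of that value leaves a subfamily where the value at \<open>i\<close> is a
  function of the restriction.\<close>

lemma nowhere_rich_determines:
  fixes F :: "('i \<Rightarrow> 'a) set"
  assumes "finite F" "F \<noteq> {}" "finite I" "\<forall>f\<in>F. \<not> rich N I F J f"
  shows "\<exists>F' i. F' \<subseteq> F \<and> i \<in> I - J \<and> determines F' J i \<and> card F \<le> card I * N * card F'"
proof -
  have "\<exists>e::nat \<Rightarrow> 'a. \<forall>g\<in>F. restrict g J = r \<longrightarrow> (\<exists>i\<in>I - J. g i \<in> e ` {..<N})" for r
  proof (cases "\<exists>f\<in>F. restrict f J = r")
    case True
    then obtain f where f: "f \<in> F" "restrict f J = r" by blast
    then obtain e :: "nat \<Rightarrow> 'a" where
      e: "\<And>g. g \<in> F \<Longrightarrow> \<forall>j\<in>J. g j = f j \<Longrightarrow> \<exists>i\<in>I - J. g i \<in> e ` {..<N}"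
      using assms(4) unfolding rich_def by meson
    have "\<forall>j\<in>J. g j = f j" if "restrict g J = r" for g
      using that f(2) by (metis restrict_apply')
    thus ?thesis using e by blast
  qed blast
  hence "\<forall>r. \<exists>e::nat \<Rightarrow> 'a. \<forall>g\<in>F. restrict g J = r \<longrightarrow> (\<exists>i\<in>I - J. g i \<in> e ` {..<N})" by blast
  from choice[OF this] obtain e :: "('i \<Rightarrow> 'a) \<Rightarrow> nat \<Rightarrow> 'a" where
    e: "\<And>g. g \<in> F \<Longrightarrow> \<exists>i\<in>I - J. g i \<in> e (restrict g J) ` {..<N}"
    by blast
  define A where "A = (\<lambda>(i, t). {g\<in>F. g i = e (restrict g J) t})"
  let ?P = "(I - J) \<times> {..<N}"
  have cover: "F \<subseteq> (\<Union>x\<in>?P. A x)" using e by (force simp: A_def)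
  have finP: "finite ?P" using assms(3) by simp
  have cardP: "card ?P \<le> card I * N" using assms(3) by (simp add: card_cartesian_product card_mono)
  have "\<exists>x\<in>?P. card F \<le> card ?P * card (A x)"
    using assms(1) by (intro card_pigeonhole_cover[OF finP assms(2) cover]) (auto simp: A_def)
  then obtain x where x: "x \<in> ?P" "card F \<le> card ?P * card (A x)" by blast
  note x(2)
  also have "\<dots> \<le> card I * N * card (A x)" using cardP by (rule mult_le_mono1)
  finally have "card F \<le> card I * N * card (A x)" .
  moreover have "determines (A x) J (fst x)"
    unfolding determines_def
  proof (intro ballI impI)
    fix f g assume fg: "f \<in> A x" "g \<in> A x" "\<forall>j\<in>J. f j = g j"
    hence "restrict f J = restrict g J" by (auto simp: restrict_def)
    thus "f (fst x) = g (fst x)" using fg by (auto simp: A_def split: prod.splits)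
  qed
  ultimately show ?thesis using x(1) by (intro exI[of _ "A x"] exI[of _ "fst x"]) (auto simp: A_def)
qed

lemma card_le_if_determines:
  assumes F: "finite F" "\<And>f. f \<in> F \<Longrightarrow> f ` S \<subseteq> V" "finite V" "finite S"
    and det: "\<And>i. i \<in> I \<Longrightarrow> determines F S i" and inj: "inj_on (\<lambda>f. restrict f I) F"
  shows "card F \<le> card V ^ card S"
proof -
  have "inj_on (\<lambda>f. restrict f S) F"
  proof (rule inj_onI)
    fix f g assume fg: "f \<in> F" "g \<in> F" "restrict f S = restrict g S"
    have "f j = g j" if "j \<in> S" for j using fg(3) that by (metis restrict_apply')
    hence "restrict f I = restrict g I" using det fg(1,2) by (auto simp: determines_def restrict_def)
    thus "f = g" using inj fg by (auto dest: inj_onD)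
  qed
  moreover have "(\<lambda>f. restrict f S) ` F \<subseteq> S \<rightarrow>\<^sub>E V"
    using F(2) by (fastforce simp: image_subset_iff)
  ultimately have "card F \<le> card (S \<rightarrow>\<^sub>E V)" using F(3,4) by (intro card_inj_on_le finite_PiE) auto
  thus ?thesis using F(4) by (simp add: card_PiE)
qed

text \<open>The exponent \<open>2 ^ m * m\<close> bounds the number of pairs \<open>(J, i)\<close> such that the coordinates in \<open>J\<close>
  may determine the coordinate \<open>i\<close>. A subfamily \<open>G\<close> maximising \<open>card G * K ^ d\<close>, with \<open>d\<close> the number of
  these determinations and \<open>K\<close> the base of the power below, has no large subfamily with a new
  determination, so cleaning it with respect to the undetermined \<open>J\<close> leaves something.\<close>

definition homogenization_const :: "nat \<Rightarrow> nat \<Rightarrow> nat" where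
  "homogenization_const m N = (2 ^ m * (m * N) + 2) ^ (2 ^ m * m)"

lemma homogeneous_subfamily:
  fixes F :: "('i \<Rightarrow> 'a) set"
  assumes F: "finite F" "\<And>f. f \<in> F \<Longrightarrow> f ` I \<subseteq> V" "finite V" "finite I" "V \<noteq> {}"
    and inj: "inj_on (\<lambda>f. restrict f I) F"
    and large: "homogenization_const (card I) N * card V ^ q < card F"
  obtains X \<J> where "X \<subseteq> F" "X \<noteq> {}" "\<And>J. J \<in> \<J> \<Longrightarrow> J \<subset> I"
    "\<And>S. S \<subseteq> I \<Longrightarrow> card S \<le> q \<Longrightarrow> \<exists>J\<in>\<J>. S \<subseteq> J"
    "\<And>J f. J \<in> \<J> \<Longrightarrow> f \<in> X \<Longrightarrow> rich N I X J f"
proof -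
  let ?m = "card I"
  define K where "K = 2 ^ ?m * (?m * N) + 2"
  define D where "D G = {(J, i). J \<subseteq> I \<and> i \<in> I - J \<and> determines G J i}" for G :: "('i \<Rightarrow> 'a) set"
  define w where "w G = card G * K ^ card (D G)" for G :: "('i \<Rightarrow> 'a) set"
  have Dsub: "D G \<subseteq> Pow I \<times> I" for G by (auto simp: D_def)
  have finD: "finite (D G)" for G using finite_subset[OF Dsub] F(4) by blast
  have cardD: "card (D G) \<le> 2 ^ ?m * ?m" for G
    using card_mono[OF _ Dsub] F(4) by (simp add: card_cartesian_product card_Pow)
  have "finite (w ` Pow F)" "w ` Pow F \<noteq> {}" using F(1) by auto
  from Max_in[OF this] obtain G where G: "G \<subseteq> F" "w G = Max (w ` Pow F)" by auto
  have max: "w H \<le> w G" if "H \<subseteq> F" for H using that G(2) F(1) by simp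
  have finG: "finite G" using G(1) F(1) finite_subset by blast
  \<comment> \<open>The power of \<open>K\<close> in the weight costs at most the factor
    \<open>homogenization_const\<close>, so the maximiser \<open>G\<close> still has more than
    \<open>card V ^ q\<close> members.\<close>
  have "card F \<le> w F" by (simp add: w_def K_def)
  also have "\<dots> \<le> w G" by (rule max) simp
  also have "\<dots> \<le> card G * K ^ (2 ^ ?m * ?m)"
    unfolding w_def using cardD by (intro mult_le_mono2 power_increasing) (auto simp: K_def)
  finally have FG: "card F \<le> homogenization_const ?m N * card G"
    by (simp add: homogenization_const_def K_def mult.commute)
  hence G_large: "card V ^ q < card G"
    using large by (meson le_less_trans less_le_trans mult_less_cancel1)
  hence G_ne: "G \<noteq> {}" by auto
  \<comment> \<open>These are the proper sets of positions closed under determination in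
    \<open>G\<close>.\<close>
  define \<J> where "\<J> = {J. J \<subset> I \<and> (\<forall>i\<in>I - J. \<not> determines G J i)}"
  have fin\<J>: "finite \<J>" by (rule finite_subset[of _ "Pow I"]) (auto simp: \<J>_def F(4))
  have card\<J>: "card \<J> \<le> 2 ^ ?m"
    using card_mono[of "Pow I" \<J>] F(4) by (auto simp: \<J>_def card_Pow)
  from rich_cleaning[OF finG, of \<J> N I] obtain X Q where XQ: "X \<subseteq> G"
    "G = X \<union> (\<Union>J\<in>\<J>. Q J)" "\<forall>J\<in>\<J>. \<forall>f\<in>X. rich N I X J f"
    "\<forall>J\<in>\<J>. \<forall>f\<in>Q J. \<not> rich N I (Q J) J f"
    by blast
  \<comment> \<open>Otherwise some \<open>Q J\<close> contains a fixed fraction of \<open>G\<close>,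
    and a subfamily \<open>F'\<close> of it gains the determination \<open>(J, i)\<close> at bounded
    cost, against the maximality of \<open>w G\<close>.\<close>
  have "X \<noteq> {}"
  proof
    assume "X = {}"
    hence GQ: "G = (\<Union>J\<in>\<J>. Q J)" using XQ(2) by simp
    hence "finite (Q J)" if "J \<in> \<J>" for J using that finG by (metis UN_upper finite_subset)
    hence "\<exists>J\<in>\<J>. card G \<le> card \<J> * card (Q J)"
      using GQ by (intro card_pigeonhole_cover[OF fin\<J> G_ne]) auto
    then obtain J where J: "J \<in> \<J>" "card G \<le> card \<J> * card (Q J)" by blast
    note J(2)
    also have "\<dots> \<le> 2 ^ ?m * card (Q J)" using card\<J> by (rule mult_le_mono1)
    finally have GQJ: "card G \<le> 2 ^ ?m * card (Q J)" .
    have "Q J \<subseteq> G" using GQ J(1) by blast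
    hence "finite (Q J)" using finG finite_subset by blast
    moreover have "Q J \<noteq> {}" using GQJ G_ne finG by auto
    ultimately obtain F' i where F': "F' \<subseteq> Q J" "i \<in> I - J" "determines F' J i"
      "card (Q J) \<le> ?m * N * card F'"
      using nowhere_rich_determines[of "Q J" I N J] F(4) XQ(4) J(1) by blast
    have F'G: "F' \<subseteq> G" using F'(1) \<open>Q J \<subseteq> G\<close> by blast
    have "insert (J, i) (D G) \<subseteq> D F'"
    proof -
      have "D G \<subseteq> D F'" using F'G unfolding D_def determines_def by blast
      moreover have "(J, i) \<in> D F'" using J(1) F'(2,3) by (auto simp: D_def \<J>_def)
      ultimately show ?thesis by blast
    qed
    moreover have "(J, i) \<notin> D G" using J(1) F'(2) by (auto simp: D_def \<J>_def)
    ultimately have "Suc (card (D G)) \<le> card (D F')"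
      using card_mono[OF finD, of "insert (J, i) (D G)" F'] finD by simp
    hence "card F' * K ^ Suc (card (D G)) \<le> w F'"
      unfolding w_def by (intro mult_le_mono2 power_increasing) (auto simp: K_def)
    also have "\<dots> \<le> w G" using F'G G(1) by (intro max) blast
    finally have "card F' * K * K ^ card (D G) \<le> card G * K ^ card (D G)"
      by (simp add: w_def algebra_simps)
    hence "card F' * K \<le> card G" by (simp add: K_def)
    also have "card G \<le> 2 ^ ?m * (?m * N * card F')"
      using GQJ F'(4) by (meson le_trans mult_le_mono2)
    \<comment> \<open>\<open>K\<close> exceeds \<open>2 ^ ?m * (?m * N)\<close> by 2.\<close>
    finally have "card F' * 2 \<le> 0" by (simp add: K_def algebra_simps)
    hence "card F' = 0" by simp
    thus False using F'(4) \<open>finite (Q J)\<close> \<open>Q J \<noteq> {}\<close> by simp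
  qed
  moreover have "\<exists>J\<in>\<J>. S \<subseteq> J" if S: "S \<subseteq> I" "card S \<le> q" for S
  proof -
    \<comment> \<open>\<open>T\<close> is the closure of \<open>S\<close>. It is proper, since
      otherwise the values at \<open>q\<close> positions would fix each member of \<open>G\<close>,
      and it is closed because determination is transitive.\<close>
    define T where "T = {i\<in>I. determines G S i}"
    have ST: "S \<subseteq> T" using S(1) by (auto simp: T_def determines_def)
    have "T \<noteq> I"
    proof
      assume "T = I"
      hence det: "determines G S i" if "i \<in> I" for i using that by (auto simp: T_def)
      have "card G \<le> card V ^ card S"
      proof (rule card_le_if_determines[OF finG _ F(3) _ det])
        show "f ` S \<subseteq> V" if "f \<in> G" for f using that F(2)[of f] G(1) S(1) by blast
        show "finite S" using S(1) F(4) finite_subset by blast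
        show "inj_on (\<lambda>f. restrict f I) G" using inj G(1) inj_on_subset by blast
      qed
      also have "\<dots> \<le> card V ^ q"
        using S(2) F(3,5) by (intro power_increasing) (auto simp: Suc_le_eq card_gt_0_iff)
      finally show False using G_large by simp
    qed
    moreover have "T \<subseteq> I" by (auto simp: T_def)
    moreover have "\<not> determines G T i" if "i \<in> I - T" for i
    proof
      assume "determines G T i"
      moreover have "\<forall>f\<in>G. \<forall>g\<in>G. (\<forall>j\<in>S. f j = g j) \<longrightarrow> (\<forall>j\<in>T. f j = g j)"
        by (auto simp: T_def determines_def)
      ultimately have "determines G S i" unfolding determines_def by meson
      thus False using that by (simp add: T_def)
    qed
    ultimately have "T \<in> \<J>" by (auto simp: \<J>_def)
    thus ?thesis using ST by blast
  qed
  ultimately show thesis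
    using that[of X \<J>] XQ(1,3) G(1) by (auto simp: \<J>_def)
qed

subsection \<open>Crossing arcs and hitting sets\<close>

definition connected_in :: "'a set set \<Rightarrow> 'a set \<Rightarrow> bool" where
  "connected_in E T \<longleftrightarrow> (\<forall>x\<in>T. \<forall>y\<in>T. (x, y) \<in> {(u, v). u \<in> T \<and> v \<in> T \<and> {u, v} \<in> E}\<^sup>*)"

text \<open>Follow a walk inside \<open>T\<close>; when it returns to a vertex of the path built so
  far, cut the path back to that vertex.\<close>

lemma connected_in_path:
  assumes "connected_in E T" "x \<in> T" "y \<in> T"
  obtains r where "r \<noteq> []" "distinct r" "set r \<subseteq> T" "hd r = x" "last r = y"
    "successively (\<lambda>u v. {u, v} \<in> E) r"
proof -
  have "(x, y) \<in> {(u, v). u \<in> T \<and> v \<in> T \<and> {u, v} \<in> E}\<^sup>*"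
    using assms by (simp add: connected_in_def)
  hence "\<exists>r. r \<noteq> [] \<and> distinct r \<and> set r \<subseteq> T \<and> hd r = x \<and> last r = y \<and>
    successively (\<lambda>u v. {u, v} \<in> E) r"
  proof (induction rule: rtrancl_induct)
    case base
    show ?case using assms(2) by (intro exI[of _ "[x]"]) simp
  next
    case (step y z)
    then obtain r where r: "r \<noteq> []" "distinct r" "set r \<subseteq> T" "hd r = x" "last r = y"
      "successively (\<lambda>u v. {u, v} \<in> E) r" by blast
    show ?case
    proof (cases "z \<in> set r")
      case True
      then obtain us vs where "r = us @ z # vs" by (auto simp: in_set_conv_decomp)
      hence r_eq: "r = (us @ [z]) @ vs" by simp
      have "successively (\<lambda>u v. {u, v} \<in> E) (us @ [z])"
        using r(6) unfolding r_eq by (simp only: successively_append_iff)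
      moreover have "hd (us @ [z]) = x" using r(4) unfolding r_eq by (cases us) auto
      ultimately show ?thesis using r(2,3) unfolding r_eq
        by (intro exI[of _ "us @ [z]"]) auto
    next
      case False
      thus ?thesis using r step(2)
        by (intro exI[of _ "r @ [z]"]) (auto simp: successively_append_iff)
    qed
  qed
  thus thesis using that by blast
qed

lemma connected_in_Un:
  assumes "connected_in E S" "connected_in E T" "S \<inter> T \<noteq> {}"
  shows "connected_in E (S \<union> T)"
proof -
  let ?R = "\<lambda>T. {(u, v). u \<in> T \<and> v \<in> T \<and> {u, v} \<in> E}"
  obtain z where z: "z \<in> S" "z \<in> T" using assms(3) by blast
  have mono: "(?R S)\<^sup>* \<subseteq> (?R (S \<union> T))\<^sup>*" "(?R T)\<^sup>* \<subseteq> (?R (S \<union> T))\<^sup>*"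
    by (rule rtrancl_mono, blast)+
  have "(x, z) \<in> (?R (S \<union> T))\<^sup>* \<and> (z, x) \<in> (?R (S \<union> T))\<^sup>*" if "x \<in> S \<union> T" for x
    using that assms(1,2) z mono unfolding connected_in_def by blast
  thus ?thesis unfolding connected_in_def by (meson rtrancl_trans)
qed

lemma connected_in_segment:
  assumes "\<And>i. {f i, f (i + 1)} \<in> E"
  shows "connected_in E (f ` {x..y::int})"
proof -
  let ?R = "{(u, v). u \<in> f ` {x..y} \<and> v \<in> f ` {x..y} \<and> {u, v} \<in> E}"
  have "sym ?R" by (auto simp: sym_def insert_commute)
  hence sym: "sym (?R\<^sup>*)" by (rule sym_rtrancl)
  have reach: "i \<le> y \<longrightarrow> (f x, f i) \<in> ?R\<^sup>*" if "x \<le> i" for i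
    using that
  proof (induction i rule: int_ge_induct)
    case (step i)
    have "(f i, f (i + 1)) \<in> ?R" if "i + 1 \<le> y" using that step(1) assms[of i] by auto
    thus ?case using step(2) by (auto intro: rtrancl_into_rtrancl)
  qed simp
  have "(f i, f j) \<in> ?R\<^sup>*" if "i \<in> {x..y}" "j \<in> {x..y}" for i j
  proof -
    have "(f x, f i) \<in> ?R\<^sup>*" "(f x, f j) \<in> ?R\<^sup>*" using reach that by auto
    thus ?thesis using sym by (meson rtrancl_trans symD)
  qed
  thus ?thesis unfolding connected_in_def by blast
qed

lemma successively_upto: "(\<And>i. P i (i + 1)) \<Longrightarrow> successively P [a..b]"
  by (auto simp: successively_conv_nth) (metis add.assoc add.commute)

lemma hd_upto: "a \<le> b \<Longrightarrow> hd [a..b] = a"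
  by (simp add: upto_rec1)

lemma last_upto: "a \<le> b \<Longrightarrow> last [a..b] = b"
  by (simp add: upto_rec2)

text \<open>Paths are read off a parametrization both forwards and backwards, hence steps of either
  sign.\<close>

lemma successively_map_steps:
  assumes "\<And>i. {f i, f (i + 1)} \<in> E" "successively (\<lambda>x y. \<bar>x - y\<bar> = (1::int)) qs"
  shows "successively (\<lambda>u v. {u, v} \<in> E) (map f qs)"
proof -
  have "{f x, f y} \<in> E" if "\<bar>x - y\<bar> = 1" for x y
  proof -
    have "y = x + 1 \<or> x = y + 1" using that by linarith
    thus ?thesis using assms(1)[of x] assms(1)[of y] by (auto simp: insert_commute)
  qed
  thus ?thesis unfolding successively_map
    by (rule successively_mono[OF assms(2)])
qed

text \<open>The situation after homogenization, for parametrized cycles of length \<open>m\<close>.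
  The bound on \<open>N\<close> lets fresh copies avoid everything that the alternating path below
  accumulates.\<close>

locale rich_cycle_family =
  fixes E :: "'a set set" and m :: int and X :: "(int \<Rightarrow> 'a) set" and \<J> :: "int set set"
    and N k l :: nat
  assumes m_ge: "3 \<le> m"
    and cyclic: "f \<in> X \<Longrightarrow> cyclic_param E m f"
    and nonempty: "X \<noteq> {}"
    and proper: "J \<in> \<J> \<Longrightarrow> J \<subset> {0..<m}"
    and all_rich: "J \<in> \<J> \<Longrightarrow> f \<in> X \<Longrightarrow> rich N {0..<m} X J f"
    and N_ge: "nat m * (2 * k + 10) \<le> N"
    and cycle_le: "C \<in> cycles E \<Longrightarrow> card C \<le> k"
    and even_cycle_ge: "C \<in> cycles E \<Longrightarrow> even (card C) \<Longrightarrow> 2 * l \<le> card C"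
begin

lemma fresh:
  assumes "J \<in> \<J>" "f \<in> X" "finite W" "card W \<le> N"
  obtains g where "g \<in> X" "\<And>i. i mod m \<in> J \<Longrightarrow> g i = f i" "\<And>i. i mod m \<notin> J \<Longrightarrow> g i \<notin> W"
proof -
  obtain g where g: "g \<in> X" "\<And>j. j \<in> J \<Longrightarrow> g j = f j" "\<And>i. i \<in> {0..<m} - J \<Longrightarrow> g i \<notin> W"
    using richD[OF all_rich[OF assms(1,2)] assms(3,4)] by blast
  note md = cyclic_param_mod[OF cyclic]
  show thesis
  proof (rule that[OF g(1)])
    fix i
    show "i mod m \<in> J \<Longrightarrow> g i = f i" using g(2)[of "i mod m"] md[OF g(1)] md[OF assms(2)] by simp
    show "i mod m \<notin> J \<Longrightarrow> g i \<notin> W" using g(3)[of "i mod m"] md[OF g(1)] m_ge by simp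
  qed
qed

lemma adjacent: "f \<in> X \<Longrightarrow> {f i, f (i + 1)} \<in> E"
  using cyclic cyclic_param_edge by blast

lemma eqD: "f \<in> X \<Longrightarrow> f i = f j \<Longrightarrow> \<bar>i - j\<bar> < m \<Longrightarrow> i = j"
  using cyclic cyclic_param_eqD by blast

lemma period: "f \<in> X \<Longrightarrow> f (i + m) = f i"
  using cyclic cyclic_param_period by blast

text \<open>A gap of some \<open>J\<close>, unrolled to the integers. The bounds on
  \<open>b - a\<close> make the interior nonempty and the two ends distinct modulo
  \<open>m\<close>.\<close>

definition arc :: "int \<Rightarrow> int \<Rightarrow> bool" where
  "arc a b \<longleftrightarrow> 2 \<le> b - a \<and> b - a < m \<and>
     (\<exists>J\<in>\<J>. a mod m \<in> J \<and> b mod m \<in> J \<and> (\<forall>i. a < i \<and> i < b \<longrightarrow> i mod m \<notin> J))"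

lemma arcE:
  assumes "arc a b"
  obtains J where "J \<in> \<J>" "a mod m \<in> J" "b mod m \<in> J" "\<And>i. a < i \<Longrightarrow> i < b \<Longrightarrow> i mod m \<notin> J"
    "2 \<le> b - a" "b - a < m"
  using assms unfolding arc_def by blast

lemma arc_shift:
  assumes "arc a b"
  shows "arc (a + t * m) (b + t * m)"
proof -
  obtain J where J: "J \<in> \<J>" "a mod m \<in> J" "b mod m \<in> J" "\<And>i. a < i \<Longrightarrow> i < b \<Longrightarrow> i mod m \<notin> J"
    "2 \<le> b - a" "b - a < m"
    using assms by (rule arcE) blast
  have "i mod m \<notin> J" if "a + t * m < i" "i < b + t * m" for i
  proof -
    have "(i - t * m) mod m \<notin> J" using that by (intro J(4)) auto
    moreover have "(i - t * m) mod m = i mod m" by (simp add: mod_eq_dvd_iff)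
    ultimately show ?thesis by simp
  qed
  thus ?thesis unfolding arc_def using J by (intro conjI bexI[of _ J]) auto
qed

text \<open>A second copy of the interior that avoids the first one closes up with it to a cycle of
  even length \<open>2 * (b - a)\<close>.\<close>

lemma arc_length_ge:
  assumes "arc a b"
  shows "int l \<le> b - a"
proof -
  obtain J where J: "J \<in> \<J>" "a mod m \<in> J" "b mod m \<in> J" "\<And>i. a < i \<Longrightarrow> i < b \<Longrightarrow> i mod m \<notin> J"
    "2 \<le> b - a" "b - a < m"
    using assms by (rule arcE) blast
  obtain f where f: "f \<in> X" using nonempty by blast
  have "card (f ` {a..b}) \<le> card {a..b}" by (rule card_image_le) simp
  also have "\<dots> \<le> nat m" using J(5,6) by simp
  also have "\<dots> \<le> N" using N_ge by (rule order_trans[rotated]) simp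
  finally have "card (f ` {a..b}) \<le> N" .
  then obtain g where g: "g \<in> X" "\<And>i. i mod m \<in> J \<Longrightarrow> g i = f i"
    "\<And>i. i mod m \<notin> J \<Longrightarrow> g i \<notin> f ` {a..b}"
    using fresh[OF J(1) f, of "f ` {a..b}"] by blast
  \<comment> \<open>Forward along \<open>f\<close>, back along \<open>g\<close>; the ranges are
    chosen so that each of the two common ends occurs once.\<close>
  define p where "p = map f [a..b - 1] @ map g (rev [a + 1..b])"
  have ends: "g a = f a" "g b = f b" using g(2) J(2,3) by auto
  have "successively (\<lambda>u v. {u, v} \<in> E) p"
    unfolding p_def successively_append_iff
  proof (intro conjI disjI2)
    show "successively (\<lambda>u v. {u, v} \<in> E) (map f [a..b - 1])"
      by (intro successively_map_steps adjacent[OF f] successively_upto) simp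
    show "successively (\<lambda>u v. {u, v} \<in> E) (map g (rev [a + 1..b]))"
      by (intro successively_map_steps adjacent[OF g(1)])
        (simp add: successively_rev successively_upto)
    show "{last (map f [a..b - 1]), hd (map g (rev [a + 1..b]))} \<in> E"
      using J(5) adjacent[OF f, of "b - 1"] ends
      by (simp add: last_map hd_map hd_rev last_upto)
  qed
  moreover have "distinct p"
  proof -
    have "inj_on f {a..b - 1}" using eqD[OF f] J(6) by (intro inj_onI) auto
    moreover have "inj_on g {a + 1..b}" using eqD[OF g(1)] J(6) by (intro inj_onI) auto
    moreover have "f i \<noteq> g j" if "i \<in> {a..b - 1}" "j \<in> {a + 1..b}" for i j
    proof (cases "j = b")
      case True
      thus ?thesis using eqD[OF f, of i b] that J(6) ends by auto
    next
      case False
      hence "g j \<notin> f ` {a..b}" using g(3)[OF J(4), of j] that by auto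
      moreover have "f i \<in> f ` {a..b}" using that by auto
      ultimately show ?thesis by metis
    qed
    ultimately show ?thesis unfolding p_def by (auto simp: distinct_map)
  qed
  moreover have "{last p, hd p} \<in> E"
    using J(5) adjacent[OF g(1), of a] ends
    by (simp add: p_def last_map hd_map last_rev hd_upto hd_append insert_commute)
  moreover have len: "length p = 2 * nat (b - a)" by (simp add: p_def)
  moreover have "3 \<le> length p" using len J(5) by simp
  ultimately have "closed_walk_edges p \<in> cycles E" "card (closed_walk_edges p) = 2 * nat (b - a)"
    using cycles_listI[of p E] by auto
  hence "2 * l \<le> 2 * nat (b - a)" using even_cycle_ge by fastforce
  thus ?thesis using J(5) by linarith
qed

section \<open>Crossing arcs\<close>

text \<open>The state of the alternating construction: \<open>p\<close> is the path so far,
  \<open>T\<close> a connected set through which it shall close up, and \<open>f\<close> the current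
  copy, whose segment from \<open>d\<close> to \<open>a + m\<close> lies in
  \<open>T\<close>.\<close>

definition zigzag :: "int \<Rightarrow> int \<Rightarrow> (int \<Rightarrow> 'a) \<Rightarrow> 'a list \<Rightarrow> 'a set \<Rightarrow> bool" where
  "zigzag a d f p T \<longleftrightarrow> f \<in> X \<and> p \<noteq> [] \<and> distinct p \<and> successively (\<lambda>u v. {u, v} \<in> E) p \<and>
     finite T \<and> set p \<inter> T = {} \<and> connected_in E T \<and> f ` {d..a + m} \<subseteq> T \<and>
     (\<exists>A\<in>T. {A, hd p} \<in> E)"

text \<open>Pass from \<open>f\<close> to a copy \<open>g\<close> that agrees with it on
  \<open>J\<close> and is fresh elsewhere. Position \<open>e\<close> joins the new piece to the end
  of \<open>p\<close>; position \<open>r\<close> joins the segment of \<open>g\<close> from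
  \<open>d\<close> to \<open>a + m\<close> to \<open>T\<close>.\<close>

lemma zigzag_step:
  assumes z: "zigzag a d f p T" "last p = f e" "card (set p \<union> T) \<le> N"
    and J: "J \<in> \<J>" "e mod m \<in> J" "r mod m \<in> J" "r \<in> {d..a + m}" "a < d"
    and qs: "qs \<noteq> []" "distinct qs" "successively (\<lambda>x y. \<bar>x - y\<bar> = 1) (e # qs)"
      "set qs \<subseteq> {a<..<d}" "\<And>i. i \<in> set qs \<Longrightarrow> i mod m \<notin> J"
  shows "\<exists>g T'. zigzag a d g (p @ map g qs) T' \<and>
    card (set (p @ map g qs) \<union> T') \<le> card (set p \<union> T) + nat m"
proof -
  note z' = z(1)[unfolded zigzag_def]
  have f: "f \<in> X" and finT: "finite T" using z' by auto
  obtain g where g: "g \<in> X" "\<And>i. i mod m \<in> J \<Longrightarrow> g i = f i"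
    "\<And>i. i mod m \<notin> J \<Longrightarrow> g i \<notin> set p \<union> T"
    using fresh[OF J(1) f, of "set p \<union> T"] finT z(3) by auto
  define S where "S = g ` {d..a + m}"
  have ge: "g e = last p" using g(2)[OF J(2)] z(2) by simp
  have gr: "g r \<in> T" using g(2)[OF J(3)] J(4) z' by auto
  have new: "g i \<notin> set p \<union> T" if "i \<in> set qs" for i using g(3) qs(5) that by blast
  \<comment> \<open>At positions in \<open>J\<close> the segment repeats vertices of
    \<open>T\<close>, at all others it is fresh; either way it misses \<open>p\<close>.\<close>
  have S_p: "set p \<inter> S = {}"
  proof -
    have "g i \<notin> set p" if "i \<in> {d..a + m}" for i
    proof (cases "i mod m \<in> J")
      case True
      hence "g i \<in> T" using g(2) z' that by auto
      thus ?thesis using z' by blast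
    qed (use g(3) in blast)
    thus ?thesis by (auto simp: S_def)
  qed
  have S_qs: "g i \<notin> S" if "i \<in> set qs" for i
  proof
    assume "g i \<in> S"
    then obtain j where j: "j \<in> {d..a + m}" "g i = g j" by (auto simp: S_def)
    moreover have "a < i" "i < d" using that qs(4) by auto
    ultimately show False using eqD[OF g(1) j(2)] by auto
  qed
  have "distinct (p @ map g qs)"
  proof -
    have "inj_on g (set qs)"
    proof (rule inj_onI)
      fix i j assume ij: "i \<in> set qs" "j \<in> set qs" "g i = g j"
      hence "i \<in> {a<..<d}" "j \<in> {a<..<d}" using qs(4) by blast+
      thus "i = j" using J(4) by (intro eqD[OF g(1) ij(3)]) auto
    qed
    thus ?thesis using z' qs(2) new by (auto simp: distinct_map)
  qed
  moreover have "successively (\<lambda>u v. {u, v} \<in> E) (p @ map g qs)"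
  proof -
    have "successively (\<lambda>u v. {u, v} \<in> E) (map g (e # qs))"
      using qs(3) by (intro successively_map_steps adjacent[OF g(1)])
    thus ?thesis using z' qs(1) ge by (auto simp: successively_append_iff successively_Cons hd_map)
  qed
  moreover have "connected_in E (T \<union> S)"
    using z' gr J(4) unfolding S_def
    by (intro connected_in_Un connected_in_segment adjacent[OF g(1)]) auto
  moreover have "set (p @ map g qs) \<inter> (T \<union> S) = {}" using z' new S_p S_qs by auto
  ultimately have "zigzag a d g (p @ map g qs) (T \<union> S)"
    using z' g(1) unfolding zigzag_def by (auto simp: S_def)
  moreover have "card (set (p @ map g qs) \<union> (T \<union> S)) \<le> card (set p \<union> T) + nat m"
  proof -
    \<comment> \<open>All added vertices are values of \<open>g\<close> on one period.\<close>
    have "set (p @ map g qs) \<union> (T \<union> S) \<subseteq> (set p \<union> T) \<union> g ` {a<..a + m}"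
      using qs(4) J(4,5) by (fastforce simp: S_def)
    hence "card (set (p @ map g qs) \<union> (T \<union> S)) \<le> card ((set p \<union> T) \<union> g ` {a<..a + m})"
      using finT by (intro card_mono) auto
    also have "\<dots> \<le> card (set p \<union> T) + card (g ` {a<..a + m})" by (rule card_Un_le)
    also have "card (g ` {a<..a + m}) \<le> card {a<..a + m}" by (rule card_image_le) simp
    finally show ?thesis by simp
  qed
  ultimately show ?thesis by blast
qed

text \<open>A path inside \<open>T\<close> from \<open>D\<close> to a neighbour of
  \<open>hd p\<close> closes \<open>p\<close> up to a cycle longer than \<open>p\<close>.\<close>

lemma zigzag_length:
  assumes z: "zigzag a d f p T" and D: "D \<in> T" "{last p, D} \<in> E" and len: "2 \<le> length p"
  shows "length p < k"
proof -
  note z' = z[unfolded zigzag_def]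
  obtain A where A: "A \<in> T" "{A, hd p} \<in> E" using z' by blast
  obtain r where r: "r \<noteq> []" "distinct r" "set r \<subseteq> T" "hd r = D" "last r = A"
    "successively (\<lambda>u v. {u, v} \<in> E) r"
    using connected_in_path[OF _ D(1) A(1)] z' by blast
  have "0 < length r" using r(1) by blast
  hence "3 \<le> length (p @ r)" using len unfolding length_append by linarith
  moreover have "distinct (p @ r)" using r(2,3) z' by auto
  moreover have "successively (\<lambda>u v. {u, v} \<in> E) (p @ r)" "{last (p @ r), hd (p @ r)} \<in> E"
    using r z' A(2) D(2) by (simp_all add: successively_append_iff)
  ultimately have "closed_walk_edges (p @ r) \<in> cycles E"
    "card (closed_walk_edges (p @ r)) = length (p @ r)"
    using cycles_listI[of "p @ r" E] by blast+
  hence "length (p @ r) \<le> k" using cycle_le by fastforce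
  thus ?thesis using r(1) by (cases r) auto
qed

text \<open>If two arcs crossed, alternating between fresh copies of their interiors would yield a path
  that shuttles between the positions \<open>c\<close> and \<open>b\<close> arbitrarily often, while the remaining parts of
  the copies form a connected set through which this path closes up to a cycle.\<close>

lemma arcs_not_crossing:
  assumes "arc a b" "arc c d" "a < c" "c < b" "b < d" "d \<le> a + m"
  shows False
proof -
  obtain J where J: "J \<in> \<J>" "a mod m \<in> J" "b mod m \<in> J" "\<And>i. a < i \<Longrightarrow> i < b \<Longrightarrow> i mod m \<notin> J"
    using assms(1) by (rule arcE) blast
  obtain J' where J': "J' \<in> \<J>" "c mod m \<in> J'" "d mod m \<in> J'"
    "\<And>i. c < i \<Longrightarrow> i < d \<Longrightarrow> i mod m \<notin> J'"
    using assms(2) by (rule arcE) blast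
  \<comment> \<open>A fresh copy of the interior of the arc from \<open>a\<close> to
    \<open>b\<close> leads from \<open>b\<close> down to \<open>c\<close>; it stays attached to
    \<open>T\<close> at \<open>a + m\<close>.\<close>
  have leftward: "\<exists>g p' T'. zigzag a d g p' T' \<and> last p' = g c \<and> length p \<le> length p' \<and>
      card (set p' \<union> T') \<le> card (set p \<union> T) + nat m"
    if z: "zigzag a d f p T" "last p = f b" "card (set p \<union> T) \<le> N" for f p T
  proof -
    have "successively (\<lambda>x y. \<bar>x - y\<bar> = 1) (b # rev [c..b - 1])"
      using assms(4)
      by (auto simp: successively_Cons successively_rev hd_rev last_upto intro!: successively_upto)
    hence "\<exists>g T'. zigzag a d g (p @ map g (rev [c..b - 1])) T' \<and>
        card (set (p @ map g (rev [c..b - 1])) \<union> T') \<le> card (set p \<union> T) + nat m"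
      using assms(3-6) J
      by (intro zigzag_step[OF z J(1,3), of "a + m"]) auto
    then obtain g T' where "zigzag a d g (p @ map g (rev [c..b - 1])) T'"
        "card (set (p @ map g (rev [c..b - 1])) \<union> T') \<le> card (set p \<union> T) + nat m" by blast
    thus ?thesis using assms(4)
      by (intro exI[of _ g] exI[of _ "p @ map g (rev [c..b - 1])"] exI[of _ T'])
        (simp add: last_map last_rev hd_upto)
  qed
  \<comment> \<open>A fresh copy of the interior of the arc from \<open>c\<close> to
    \<open>d\<close> leads up from \<open>c\<close> and stays attached at \<open>d\<close>. The
    target \<open>x\<close> is \<open>b\<close> while shuttling and \<open>d - 1\<close> at the very
    end.\<close>
  have rightward: "\<exists>g p' T'. zigzag a d g p' T' \<and> last p' = g x \<and> length p < length p' \<and>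
      card (set p' \<union> T') \<le> card (set p \<union> T) + nat m"
    if z: "zigzag a d f p T" "last p = f c" "card (set p \<union> T) \<le> N" and x: "c < x" "x < d"
    for f p T x
  proof -
    have "successively (\<lambda>x y. \<bar>x - y\<bar> = 1) (c # [c + 1..x])"
      using x by (auto simp: successively_Cons hd_upto intro!: successively_upto)
    hence "\<exists>g T'. zigzag a d g (p @ map g [c + 1..x]) T' \<and>
        card (set (p @ map g [c + 1..x]) \<union> T') \<le> card (set p \<union> T) + nat m"
      using assms(3-6) J' x
      by (intro zigzag_step[OF z J'(1,2,3)]) auto
    then obtain g T' where "zigzag a d g (p @ map g [c + 1..x]) T'"
        "card (set (p @ map g [c + 1..x]) \<union> T') \<le> card (set p \<union> T) + nat m" by blast
    thus ?thesis using x
      by (intro exI[of _ g] exI[of _ "p @ map g [c + 1..x]"] exI[of _ T'])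
        (simp add: last_map last_upto)
  qed
  have bound: "x \<le> N" if "x \<le> nat m * s" "s \<le> 2 * k + 10" for x s
    using that(1) mult_le_mono2[OF that(2)] N_ge by (meson order_trans)
  have "\<exists>f p T. zigzag a d f p T \<and> last p = f b \<and> t < length p \<and>
      card (set p \<union> T) \<le> nat m * (2 * t + 1)" if "t \<le> k + 2" for t
    using that
  proof (induction t)
    case 0
    \<comment> \<open>The start uses a single copy: the path runs from \<open>a + 1\<close> to
      \<open>b\<close>, and the edge between \<open>a\<close> and \<open>a + 1\<close> links it to
      the segment from \<open>d\<close> to \<open>a + m\<close>.\<close>
    obtain f where f: "f \<in> X" using nonempty by blast
    define p where "p = map f [a + 1..b]"
    define T where "T = f ` {d..a + m}"
    have "inj_on f {a + 1..a + m}" using eqD[OF f] by (intro inj_onI) auto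
    hence "inj_on f {a + 1..b}" by (rule inj_on_subset) (use assms(5,6) in auto)
    moreover have "f i \<noteq> f j" if "i \<in> {a + 1..b}" "j \<in> {d..a + m}" for i j
      using eqD[OF f, of i j] that assms(5) by auto
    moreover have "{f (a + m), f (a + 1)} \<in> E" using adjacent[OF f, of a] period[OF f, of a] by simp
    ultimately have "zigzag a d f p T"
      unfolding zigzag_def using f assms(3-6)
      by (auto simp: p_def T_def distinct_map hd_map hd_upto
          intro!: connected_in_segment successively_map_steps successively_upto adjacent[OF f]
            bexI[of _ "f (a + m)"])
    moreover have "last p = f b" using assms(3,4) by (simp add: p_def last_map last_upto)
    moreover have "card (set p \<union> T) \<le> nat m"
    proof -
      have "card (set p \<union> T) \<le> card (f ` {a<..a + m})"
        using assms(3-6) by (intro card_mono) (auto simp: p_def T_def)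
      also have "\<dots> \<le> card {a<..a + m}" by (rule card_image_le) simp
      finally show ?thesis by simp
    qed
    moreover have "0 < length p" using assms(3,4) by (simp add: p_def)
    ultimately show ?case by (metis mult_0_right add_0 nat_mult_1_right)
  next
    case (Suc t)
    obtain f p T where z: "zigzag a d f p T" "last p = f b" "t < length p"
      "card (set p \<union> T) \<le> nat m * (2 * t + 1)"
      using Suc by auto
    have "card (set p \<union> T) \<le> N" by (rule bound[OF z(4)]) (use Suc(2) in simp)
    from leftward[OF z(1,2) this] obtain f' p' T' where z':
      "zigzag a d f' p' T'" "last p' = f' c" "t < length p'"
      "card (set p' \<union> T') \<le> nat m * (2 * t + 2)"
      using z(3,4) by fastforce
    have "card (set p' \<union> T') \<le> N" by (rule bound[OF z'(4)]) (use Suc(2) in simp)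
    from rightward[OF z'(1,2) this assms(4,5)] show ?case using z'(3,4) by fastforce
  qed
  from this[of "k + 2"] obtain f p T where z: "zigzag a d f p T" "last p = f b" "k + 2 < length p"
      "card (set p \<union> T) \<le> nat m * (2 * (k + 2) + 1)" by auto
  have "card (set p \<union> T) \<le> N" by (rule bound[OF z(4)]) simp
  from leftward[OF z(1,2) this] obtain f' p' T' where z':
      "zigzag a d f' p' T'" "last p' = f' c" "k + 2 < length p'"
      "card (set p' \<union> T') \<le> nat m * (2 * (k + 2) + 2)"
    using z(3,4) by fastforce
  have "card (set p' \<union> T') \<le> N" by (rule bound[OF z'(4)]) simp
  \<comment> \<open>Stopping at \<open>d - 1\<close> makes the last vertex adjacent to
    \<open>g d\<close> in \<open>S\<close>, so that \<open>zigzag_length\<close> applies to a path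
    with more than \<open>k + 2\<close> vertices.\<close>
  from rightward[OF z'(1,2) this, of "d - 1"] assms(4,5) z'(3)
  obtain g r S where g: "zigzag a d g r S" "last r = g (d - 1)" "k + 2 < length r" by fastforce
  have "g d \<in> S" using g(1) assms(6) by (auto simp: zigzag_def)
  moreover have "{last r, g d} \<in> E" using g adjacent[of g "d - 1"] by (simp add: zigzag_def)
  ultimately have "length r < k" using g(3) by (intro zigzag_length[OF g(1)]) auto
  thus False using g(3) by simp
qed

end

section \<open>Hitting sets for arcs\<close>

context rich_cycle_family
begin

text \<open>Enlarge a position \<open>x\<close> outside \<open>J\<close> to the full gap of
  \<open>J\<close> around it. As \<open>J\<close> contains two different residues from
  \<open>S\<close>, this gap is shorter than a full turn.\<close>

lemma arc_avoiding:
  assumes J: "J \<in> \<J>" "(\<lambda>s. s mod m) ` S \<subseteq> J" and S: "s \<in> S" "s' \<in> S" "s mod m \<noteq> s' mod m"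
  obtains a b where "arc a b" "\<And>i t. a < i \<Longrightarrow> i < b \<Longrightarrow> t \<in> S \<Longrightarrow> i mod m \<noteq> t mod m"
proof -
  obtain x where x: "x \<in> {0..<m}" "x \<notin> J" using proper[OF J(1)] by blast
  \<comment> \<open>The representative of \<open>t\<close> modulo \<open>m\<close> in the window of
    \<open>m\<close> positions that ends at \<open>x\<close>.\<close>
  define before where "before t = x - (x - t) mod m" for t
  have before_mod: "before t mod m = t mod m" for t
    unfolding before_def by (simp add: mod_simps)
  have before_bounds: "x - m < before t" "before t \<le> x" for t
    using m_ge by (auto simp: before_def)
  have xJ: "x mod m \<notin> J" using x by simp
  have inJ: "t mod m \<in> J" if "t \<in> S" for t using J(2) that by blast
  let ?P = "{i. x - m \<le> i \<and> i \<le> x \<and> i mod m \<in> J}"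
  let ?Q = "{i. x \<le> i \<and> i \<le> x + m \<and> i mod m \<in> J}"
  have finP: "finite ?P" by (rule finite_subset[of _ "{x - m..x}"]) auto
  have finQ: "finite ?Q" by (rule finite_subset[of _ "{x..x + m}"]) auto
  have beforeP: "before t \<in> ?P" if "t \<in> S" for t
    using before_bounds[of t] before_mod[of t] inJ[OF that] by auto
  have beforeQ: "before t + m \<in> ?Q" if "t \<in> S" for t
    using before_bounds[of t] before_mod[of t] inJ[OF that] by auto
  define a where "a = Max ?P"
  define b where "b = Min ?Q"
  have "a \<in> ?P" unfolding a_def using beforeP[OF S(1)] by (intro Max_in finP) blast
  hence a: "a < x" "a mod m \<in> J" using xJ by (auto simp: le_less)
  have "b \<in> ?Q" unfolding b_def using beforeQ[OF S(1)] by (intro Min_in finQ) blast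
  hence b: "x < b" "b mod m \<in> J" using xJ by (auto simp: le_less)
  have a_ge: "before t \<le> a" if "t \<in> S" for t unfolding a_def by (intro Max_ge finP beforeP that)
  have b_le: "b \<le> before t + m" if "t \<in> S" for t unfolding b_def by (intro Min_le finQ beforeQ that)
  have lt: "b - a < m"
  proof (rule ccontr)
    assume "\<not> b - a < m"
    hence "before s = before s'" using a_ge[OF S(1)] b_le[OF S(1)] a_ge[OF S(2)] b_le[OF S(2)] by linarith
    thus False using before_mod[of s] before_mod[of s'] S(3) by simp
  qed
  have gap: "i mod m \<notin> J" if "a < i" "i < b" for i
  proof
    assume i: "i mod m \<in> J"
    show False
    proof (cases "i \<le> x")
      case True
      hence "i \<in> ?P" using that i lt b(1) by auto
      hence "i \<le> a" unfolding a_def by (intro Max_ge finP)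
      thus False using that by simp
    next
      case False
      hence "i \<in> ?Q" using that i lt a(1) by auto
      hence "b \<le> i" unfolding b_def by (intro Min_le finQ)
      thus False using that by simp
    qed
  qed
  have "arc a b" unfolding arc_def using a b gap lt J(1) by (intro conjI bexI[of _ J]) auto
  thus thesis using that gap inJ by metis
qed

lemma arc_shift_to:
  assumes "arc a b"
  obtains t where "arc (a + t * m) (b + t * m)" "y \<le> a + t * m" "a + t * m < y + m"
proof (rule that[of "- ((a - y) div m)"])
  show "arc (a + - ((a - y) div m) * m) (b + - ((a - y) div m) * m)" using assms by (rule arc_shift)
  have "a + - ((a - y) div m) * m = y + (a - y) mod m"
    using div_mult_mod_eq[of "a - y" m] by linarith
  thus "y \<le> a + - ((a - y) div m) * m" "a + - ((a - y) div m) * m < y + m"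
    using m_ge pos_mod_bound[of m "a - y"] pos_mod_sign[of m "a - y"] by simp_all
qed

text \<open>The point in front of the earliest end \<open>b\<close> of an arc hits all arcs not starting after it: an arc
  starting exactly there would cross the chosen one.\<close>

lemma interval_hitting_set:
  assumes "x \<le> y" "y \<le> x + m"
  shows "\<exists>S. finite S \<and> S \<subseteq> {x<..<y} \<and> int (card S) * int l \<le> y - x \<and>
    (\<forall>c d. arc c d \<longrightarrow> x \<le> c \<longrightarrow> d \<le> y \<longrightarrow> (\<exists>s\<in>S. c < s \<and> s < d))"
  using assms
proof (induction "nat (y - x)" arbitrary: x rule: less_induct)
  case less
  show ?case
  proof (cases "\<exists>a b. arc a b \<and> x \<le> a \<and> b \<le> y")
    case False
    thus ?thesis using less.prems by (intro exI[of _ "{}"]) auto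
  next
    case True
    then obtain a0 b0 where "arc a0 b0 \<and> x \<le> a0 \<and> b0 \<le> y" by blast
    \<comment> \<open>The arc with the earliest end is chosen and the induction continues from
      \<open>b\<close>; the length of the arc, at least \<open>l\<close>, pays for the point
      \<open>b - 1\<close>.\<close>
    then obtain a b where ab: "arc a b" "x \<le> a" "b \<le> y"
      and min: "\<And>c d. arc c d \<Longrightarrow> x \<le> c \<Longrightarrow> d \<le> y \<Longrightarrow> nat (b - x) \<le> nat (d - x)"
      using ex_has_least_nat[of "\<lambda>(a, b). arc a b \<and> x \<le> a \<and> b \<le> y" "(a0, b0)" "\<lambda>(a, b). nat (b - x)"]
      by auto
    have len: "2 \<le> b - a" "int l \<le> b - a" using ab(1) arc_length_ge by (auto simp: arc_def)
    obtain S where S: "finite S" "S \<subseteq> {b<..<y}" "int (card S) * int l \<le> y - b"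
      "\<And>c d. arc c d \<Longrightarrow> b \<le> c \<Longrightarrow> d \<le> y \<Longrightarrow> \<exists>s\<in>S. c < s \<and> s < d"
      using less.hyps[of b] less.prems ab len by auto
    show ?thesis
    proof (intro exI[of _ "insert (b - 1) S"] conjI allI impI)
      show "insert (b - 1) S \<subseteq> {x<..<y}" using S(2) ab len by auto
      have "b - 1 \<notin> S" using S(2) by auto
      thus "int (card (insert (b - 1) S)) * int l \<le> y - x"
        using S(1,3) len(2) ab(2) by (simp add: algebra_simps)
      fix c d assume cd: "arc c d" "x \<le> c" "d \<le> y"
      have cd_len: "2 \<le> d - c" using cd(1) by (simp add: arc_def)
      have "b \<le> d" using min[OF cd] cd cd_len ab len by linarith
      show "\<exists>s\<in>insert (b - 1) S. c < s \<and> s < d"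
      proof (cases "b \<le> c")
        case True
        thus ?thesis using S(4)[OF cd(1) _ cd(3)] by blast
      next
        case False
        have "c \<noteq> b - 1"
          using arcs_not_crossing[OF ab(1) cd(1)] cd cd_len ab len less.prems(2) by auto
        thus ?thesis using False \<open>b \<le> d\<close> by (intro bexI[of _ "b - 1"]) auto
      qed
    qed (use S(1) in simp)
  qed
qed

text \<open>Take a shortest arc from \<open>a\<close> to \<open>b\<close> and a set hitting all arcs
  in the rest of the circle. By the lengths, this set and \<open>b - 1\<close> together have at most
  \<open>q\<close> points. An arc avoiding them would be hit after all or would cross the chosen arc
  or a translate of it.\<close>

lemma not_every_small_set_covered:
  assumes q: "2 \<le> q" "m < int (Suc q) * int l"
  shows "\<exists>S\<subseteq>{0..<m}. card S \<le> q \<and> \<not> (\<exists>J\<in>\<J>. S \<subseteq> J)"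
proof (rule ccontr)
  assume "\<not> ?thesis"
  hence cover: "\<exists>J\<in>\<J>. S \<subseteq> J" if "S \<subseteq> {0..<m}" "card S \<le> q" for S using that by blast
  have avoid: "\<exists>c d. arc c d \<and> (\<forall>i t. c < i \<longrightarrow> i < d \<longrightarrow> t \<in> S \<longrightarrow> i mod m \<noteq> t mod m)"
    if S: "finite S" "card S \<le> q" "s \<in> S" "s' \<in> S" "s mod m \<noteq> s' mod m" for S s s'
  proof -
    have "(\<lambda>s. s mod m) ` S \<subseteq> {0..<m}" using m_ge by auto
    moreover have "card ((\<lambda>s. s mod m) ` S) \<le> q"
      using card_image_le[OF S(1)] S(2) by (rule order_trans)
    ultimately obtain J where "J \<in> \<J>" "(\<lambda>s. s mod m) ` S \<subseteq> J" using cover by blast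
    thus ?thesis using arc_avoiding[of J S s s'] S(3-5) by metis
  qed
  have "\<exists>c d. arc c d" using avoid[of "{0, 1}" 0 1] q(1) m_ge by auto
  then obtain c0 d0 where "arc c0 d0" by blast
  then obtain a b where ab: "arc a b"
    and shortest: "\<And>c d. arc c d \<Longrightarrow> nat (b - a) \<le> nat (d - c)"
    using ex_has_least_nat[of "\<lambda>(a, b). arc a b" "(c0, d0)" "\<lambda>(a, b). nat (b - a)"] by auto
  have len: "2 \<le> b - a" "int l \<le> b - a" "b - a < m"
    using ab arc_length_ge by (auto simp: arc_def)
  obtain S where S: "finite S" "S \<subseteq> {b<..<a + m}" "int (card S) * int l \<le> a + m - b"
    "\<And>c d. arc c d \<Longrightarrow> b \<le> c \<Longrightarrow> d \<le> a + m \<Longrightarrow> \<exists>s\<in>S. c < s \<and> s < d"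
    using interval_hitting_set[of b "a + m"] len by auto
  \<comment> \<open>\<open>arc_avoiding\<close> requires two residues. A point of \<open>S\<close>
    serves as the second one at no cost; if \<open>S\<close> is empty, \<open>a\<close> is added,
    which is affordable as \<open>2 \<le> q\<close>.\<close>
  define e where "e = (if S = {} then a else SOME s. s \<in> S)"
  have e: "e \<in> S \<or> S = {} \<and> e = a" by (auto simp: e_def intro: someI)
  let ?S = "insert e (insert (b - 1) S)"
  have "b - 1 \<notin> S" using S(2) by auto
  have "int (Suc (card S)) * int l \<le> m" using S(3) len by (simp add: algebra_simps)
  hence "int (Suc (card S)) * int l < int (Suc q) * int l" using q(2) by linarith
  hence "card S < q" by (simp add: mult_less_cancel_right)
  hence card: "card ?S \<le> q" using e q(1) S(1) by (auto simp: insert_absorb card_insert_if)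
  have e_bounds: "a \<le> e" "e < a + m" "e \<noteq> b - 1" using e S(2) len by auto
  moreover have "\<bar>e - (b - 1)\<bar> < m" using e_bounds len by linarith
  ultimately have "e mod m \<noteq> (b - 1) mod m" using mod_eq_int_window[of e m "b - 1"] by blast
  then obtain c' d' where cd': "arc c' d'"
    "\<And>i t. c' < i \<Longrightarrow> i < d' \<Longrightarrow> t \<in> ?S \<Longrightarrow> i mod m \<noteq> t mod m"
    using avoid[of ?S e "b - 1"] S(1) card by auto
  obtain u where u: "arc (c' + u * m) (d' + u * m)" "a \<le> c' + u * m" "c' + u * m < a + m"
    using arc_shift_to[OF cd'(1)] by blast
  define c d where "c = c' + u * m" and "d = d' + u * m"
  have cd: "arc c d" "a \<le> c" "c < a + m" using u by (auto simp: c_def d_def)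
  have miss: "\<not> (c < i \<and> i < d)" if "t \<in> ?S" "i = t + v * m" for i t v
  proof
    assume "c < i \<and> i < d"
    hence "(i - u * m) mod m \<noteq> t mod m" using cd'(2)[of "i - u * m" t] that(1) by (simp add: c_def d_def)
    thus False using that(2) by (simp add: mod_eq_dvd_iff algebra_simps)
  qed
  have cd_len: "2 \<le> d - c" "b - a \<le> d - c" "d - c < m" using cd(1) shortest[OF cd(1)] len by (auto simp: arc_def)
  have miss_b: "\<not> (c < b - 1 \<and> b - 1 < d)" "\<not> (c < b - 1 + m \<and> b - 1 + m < d)"
    using miss[of "b - 1" "b - 1" 0] miss[of "b - 1" "b - 1 + m" 1] by auto
  have miss_S: "\<not> (c < s \<and> s < d)" if "s \<in> S" for s using miss[of s s 0] that by auto
  have arc_m: "arc (a + m) (b + m)" using arc_shift[OF ab, of 1] by simp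
  show False
  proof (cases "b \<le> c")
    case True
    show False
    proof (cases "d \<le> a + m")
      case True
      thus False using S(4)[OF cd(1) \<open>b \<le> c\<close>] miss_S by blast
    next
      case False
      \<comment> \<open>The arc runs past \<open>a + m\<close> and so crosses the translate of the
        shortest arc.\<close>
      hence "d < b + m" using miss_b(2) cd(3) len by linarith
      thus False
        by (intro arcs_not_crossing[OF cd(1) arc_m]) (use False cd \<open>b \<le> c\<close> in linarith)+
    qed
  next
    case False
    \<comment> \<open>By minimality the avoiding arc cannot end before \<open>b\<close>, so it
      starts at \<open>b - 1\<close>. As it does not cross the shortest arc, it passes
      \<open>a + m\<close> and thus covers all of \<open>S\<close> or, if \<open>S\<close> is empty,
      the translate of \<open>e = a\<close>.\<close>
    hence c: "c = b - 1" using miss_b(1) cd cd_len len by linarith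
    hence "b < d" using cd_len by linarith
    have "a < c" using c len by linarith
    have "c < b" using c by simp
    hence "a + m < d"
      using arcs_not_crossing[OF ab cd(1) \<open>a < c\<close> _ \<open>b < d\<close>] not_le by blast
    hence "\<not> (e \<in> S)" using miss_S[of e] S(2) c by auto
    hence "e = a" using e by blast
    thus False using miss[of e "a + m" 1] cd \<open>a + m < d\<close> by simp
  qed
qed

end

subsection \<open>Upper bound\<close>

text \<open>Too many parametrizations would yield a \<open>rich_cycle_family\<close> in which every
  set of at most \<open>k div l\<close> positions is covered, and
  \<open>n < Suc (k div l) * l\<close> excludes this.\<close>

lemma card_cycles_of_length_le:
  assumes G: "simple_graph V E" "V \<noteq> {}"
    and le: "\<And>C. C \<in> cycles E \<Longrightarrow> card C \<le> k"
    and even_ge: "\<And>C. C \<in> cycles E \<Longrightarrow> even (card C) \<Longrightarrow> 2 * l \<le> card C"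
    and l: "0 < l" "2 * l \<le> k" and n: "3 \<le> n" "n \<le> k"
  shows "card {C \<in> cycles E. card C = n}
    \<le> homogenization_const n (n * (2 * k + 10)) * card V ^ (k div l)"
proof -
  define F where "F = {f. cyclic_param E (int n) f}"
  let ?I = "{0..<int n}"
  have finV: "finite V" using G(1) by (simp add: simple_graph_def)
  have img: "f ` I' \<subseteq> V" if "f \<in> F" for f I'
  proof -
    have "f i \<in> V" for i
      using cyclic_param_edge[of E "int n" f i] that G(1) by (auto simp: F_def simple_graph_def)
    thus ?thesis by blast
  qed
  have inj: "inj_on (\<lambda>f. restrict f ?I) F"
  proof (rule inj_onI)
    fix f g assume fg: "f \<in> F" "g \<in> F" "restrict f ?I = restrict g ?I"
    have "f i = g i" for i
    proof -
      have "i mod int n \<in> ?I" using n(1) by simp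
      hence "f (i mod int n) = g (i mod int n)" using fg(3) by (metis restrict_apply')
      thus ?thesis using fg(1,2) cyclic_param_mod unfolding F_def by (metis mem_Collect_eq)
    qed
    thus "f = g" by blast
  qed
  have finF: "finite F"
  proof (rule inj_on_finite[OF inj])
    show "(\<lambda>f. restrict f ?I) ` F \<subseteq> (?I \<rightarrow>\<^sub>E V)" using img by (fastforce simp: image_subset_iff)
    show "finite (?I \<rightarrow>\<^sub>E V)" using finV by (intro finite_PiE) auto
  qed
  have "{C \<in> cycles E. card C = n} \<subseteq> (\<lambda>f. (\<lambda>i. {f i, f (i + 1)}) ` ?I) ` F"
    by (auto simp: F_def elim!: cycles_cyclic_param)
  hence "card {C \<in> cycles E. card C = n} \<le> card F" by (rule surj_card_le[OF finF])
  also have "card F \<le> homogenization_const n (n * (2 * k + 10)) * card V ^ (k div l)"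
  proof (rule ccontr)
    assume "\<not> ?thesis"
    hence "homogenization_const (card ?I) (n * (2 * k + 10)) * card V ^ (k div l) < card F" by simp
    then obtain X \<J> where X: "X \<subseteq> F" "X \<noteq> {}" "\<And>J. J \<in> \<J> \<Longrightarrow> J \<subset> ?I"
      and cover: "\<And>S. S \<subseteq> ?I \<Longrightarrow> card S \<le> k div l \<Longrightarrow> \<exists>J\<in>\<J>. S \<subseteq> J"
      and rich: "\<And>J f. J \<in> \<J> \<Longrightarrow> f \<in> X \<Longrightarrow> rich (n * (2 * k + 10)) ?I X J f"
      using homogeneous_subfamily[OF finF img finV _ G(2) inj] by blast
    interpret rich_cycle_family E "int n" X \<J> "n * (2 * k + 10)" k l
      using X rich n le even_ge by unfold_locales (auto simp: F_def)
    have "2 \<le> k div l" using l by (simp add: less_eq_div_iff_mult_less_eq)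
    moreover have "n < Suc (k div l) * l" using n(2) l(1) dividend_less_div_times[of l k] by simp
    hence "int n < int (Suc (k div l)) * int l" by (simp only: of_nat_mult[symmetric] of_nat_less_iff)
    ultimately show False using not_every_small_set_covered[of "k div l"] cover by blast
  qed
  finally show ?thesis .
qed

lemma max_cycles_le:
  assumes "finite L" "\<forall>m\<in>L. 3 \<le> m" "\<forall>m\<in>L. m \<le> k" "\<forall>m\<in>L. even m \<longrightarrow> 2 * l \<le> m"
    "0 < l" "2 * l \<le> k" "0 < n"
  shows "max_cycles L n
    \<le> (\<Sum>m\<in>L. homogenization_const m (m * (2 * k + 10))) * n ^ (k div l)"
proof -
  have "card (cycles E) \<le> (\<Sum>m\<in>L. homogenization_const m (m * (2 * k + 10))) * n ^ (k div l)"
    if E: "L_cycle_graph L {..<n} E" for E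
  proof -
    have in_L: "card C \<in> L" if "C \<in> cycles E" for C using E that by (simp add: L_cycle_graph_def)
    have "cycles E = (\<Union>m\<in>L. {C \<in> cycles E. card C = m})" using in_L by blast
    hence "card (cycles E) \<le> (\<Sum>m\<in>L. card {C \<in> cycles E. card C = m})"
      using card_UN_le[OF assms(1)] by metis
    also have "\<dots> \<le> (\<Sum>m\<in>L. homogenization_const m (m * (2 * k + 10)) * n ^ (k div l))"
    proof (rule sum_mono)
      fix m assume "m \<in> L"
      thus "card {C \<in> cycles E. card C = m} \<le> homogenization_const m (m * (2 * k + 10)) * n ^ (k div l)"
        using card_cycles_of_length_le[of "{..<n}" E k l m] E in_L assms
        by (auto simp: L_cycle_graph_def lessThan_empty_iff)
    qed
    finally show ?thesis by (simp add: sum_distrib_right)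
  qed
  thus ?thesis
    unfolding max_cycles_def
    using Max_in[OF max_cycles_range_finite max_cycles_range_nonempty, of L n] by auto
qed

subsection \<open>Lower bound\<close>

lemma cyclic_param_reverse:
  assumes "cyclic_param E m f"
  shows "cyclic_param E m (\<lambda>i. f (- i))"
  unfolding cyclic_param_def
proof (intro conjI allI)
  fix i j
  show "{f (- i), f (- (i + 1))} \<in> E"
    using cyclic_param_edge[OF assms, of "- i - 1"] by (simp add: insert_commute)
  have "m dvd - i - - j \<longleftrightarrow> m dvd i - j" using dvd_minus_iff[of m "i - j"] by simp
  thus "f (- i) = f (- j) \<longleftrightarrow> i mod m = j mod m"
    by (simp add: cyclic_param_eq_iff[OF assms] mod_eq_dvd_iff)
qed

lemma cyclic_param_shift:
  assumes "cyclic_param E m f"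
  shows "cyclic_param E m (\<lambda>i. f (r + i))"
  unfolding cyclic_param_def
proof (intro conjI allI)
  fix i j
  show "{f (r + i), f (r + (i + 1))} \<in> E"
    using cyclic_param_edge[OF assms, of "r + i"] by (simp only: add.assoc)
  show "f (r + i) = f (r + j) \<longleftrightarrow> i mod m = j mod m"
    by (simp add: cyclic_param_eq_iff[OF assms] mod_eq_dvd_iff)
qed

lemma Union_closed_walk_edges:
  assumes "vs \<noteq> []"
  shows "\<Union>(closed_walk_edges vs) = set vs"
proof
  show "\<Union>(closed_walk_edges vs) \<subseteq> set vs" using assms by (auto simp: closed_walk_edges_def)
  show "set vs \<subseteq> \<Union>(closed_walk_edges vs)"
    by (fastforce simp: closed_walk_edges_def in_set_conv_nth)
qed

text \<open>The extremal graph is a cycle of length \<open>k\<close> in which \<open>k div l\<close> consecutive segments of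
  length \<open>l\<close> are each replaced by \<open>M\<close> parallel paths. The vertex \<open>v\<close> is the copy with number
  \<open>v div k\<close> of the position \<open>v mod k\<close>; the ends of the segments and the positions outside all
  segments have only the copy with number \<open>0\<close>.\<close>

locale theta_cycle =
  fixes k l M :: nat
  assumes l_ge: "2 \<le> l" and k_ge: "2 * l \<le> k" and M_pos: "0 < M"
begin

definition single :: "nat \<Rightarrow> bool" where
  "single p \<longleftrightarrow> l dvd p \<or> (k div l) * l \<le> p"

definition vertex :: "nat \<Rightarrow> bool" where
  "vertex v \<longleftrightarrow> v < k * M \<and> (single (v mod k) \<longrightarrow> v div k = 0)"

text \<open>Edges are oriented by increasing position modulo \<open>k\<close>, so that cycles can be
  classified by their turning points.\<close>

definition arrow :: "nat \<Rightarrow> nat \<Rightarrow> bool" where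
  "arrow u v \<longleftrightarrow> vertex u \<and> vertex v \<and> v mod k = Suc (u mod k) mod k \<and>
     (single (u mod k) \<or> single (v mod k) \<or> u div k = v div k)"

definition edges :: "nat set set" where
  "edges = {{u, v} | u v. arrow u v}"

lemma k_pos: "0 < k" "1 < k" "l < k"
  using l_ge k_ge by auto

lemma segments_le: "(k div l) * l \<le> k"
  by simp

lemma segment_end_le:
  assumes "l dvd p" "p < (k div l) * l"
  shows "p + l \<le> (k div l) * l"
proof -
  obtain j where j: "p = l * j" using assms(1) by (elim dvdE)
  hence "Suc j \<le> k div l" using assms(2) by (simp add: mult.commute)
  hence "Suc j * l \<le> (k div l) * l" by (rule mult_le_mono1)
  thus ?thesis using j by (simp add: mult.commute)
qed

lemma vertex_eqI:
  assumes "u mod k = v mod k" "u div k = v div k"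
  shows "u = v"
  using assms by (metis div_mult_mod_eq)

lemma single_vertex_eqI:
  assumes "vertex u" "vertex v" "u mod k = v mod k" "single (v mod k)"
  shows "u = v"
  using assms vertex_eqI[of u v] by (simp add: vertex_def)

lemma arrow_cases: "{u, v} \<in> edges \<Longrightarrow> arrow u v \<or> arrow v u"
  by (auto simp: edges_def doubleton_eq_iff)

lemma arrowD:
  assumes "arrow u v"
  shows "vertex u" "vertex v" "v mod k = Suc (u mod k) mod k"
    "\<not> single (u mod k) \<Longrightarrow> \<not> single (v mod k) \<Longrightarrow> u div k = v div k"
  using assms unfolding arrow_def by blast+

text \<open>The preceding position is either single or occupied by the same copy number.\<close>

lemma arrow_source_unique:
  assumes "arrow u w" "arrow u' w" "\<not> single (w mod k)"
  shows "u = u'"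
proof -
  have "Suc (u mod k) mod k = Suc (u' mod k) mod k"
    using arrowD(3)[OF assms(1)] arrowD(3)[OF assms(2)] by argo
  hence pos: "u mod k = u' mod k" using k_pos by (auto simp: mod_Suc split: if_splits)
  show ?thesis
  proof (cases "single (u mod k)")
    case True
    thus ?thesis
      using single_vertex_eqI[OF arrowD(1)[OF assms(1)] arrowD(1)[OF assms(2)] pos] pos by metis
  next
    case False
    hence "u div k = u' div k"
      using arrowD(4)[OF assms(1)] arrowD(4)[OF assms(2)] assms(3) pos by metis
    with pos show ?thesis by (rule vertex_eqI)
  qed
qed

lemma simple_graph_edges:
  assumes "k * M \<le> n"
  shows "simple_graph {..<n} edges"
proof -
  have "u \<noteq> v \<and> u < n \<and> v < n" if "arrow u v" for u v
  proof -
    have "u mod k \<noteq> v mod k"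
      unfolding arrowD(3)[OF that] using k_pos by (simp add: mod_Suc)
    moreover have "u < k * M" "v < k * M" using arrowD(1,2)[OF that] by (simp_all add: vertex_def)
    ultimately show ?thesis using assms by auto
  qed
  thus ?thesis by (fastforce simp: simple_graph_def edges_def)
qed

section \<open>Cycle lengths in the extremal graph\<close>

text \<open>Positions advance by one modulo \<open>k\<close>, so \<open>k\<close> divides
  \<open>t\<close>. Position 0 has only one vertex, so the cycle repeats after \<open>k\<close>
  steps and \<open>t\<close> divides \<open>k\<close>.\<close>

lemma monotone_cycle_length:
  assumes g: "cyclic_param edges (int t) g" and up: "\<And>i. arrow (g i) (g (i + 1))"
  shows "t = k"
proof -
  have pos: "g (int s) mod k = (g 0 + s) mod k" for s
  proof (induction s)
    case (Suc s)
    have "g (int (Suc s)) mod k = Suc (g (int s) mod k) mod k"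
      using arrowD(3)[OF up[of "int s"]] by (simp add: add.commute)
    thus ?case using Suc by (simp add: mod_Suc_eq)
  qed simp
  define s where "s = k - g 0 mod k"
  have "(g 0 + s) mod k = (g 0 mod k + s) mod k" by (simp add: mod_add_left_eq)
  also have "\<dots> = 0" using k_pos by (simp add: s_def)
  finally have "g (int s) mod k = 0" "g (int (s + k)) mod k = 0"
    using pos[of s] pos[of "s + k"] by (simp_all add: add.assoc[symmetric])
  hence "g (int s) = g (int (s + k))"
    using single_vertex_eqI[OF arrowD(1)[OF up[of "int s"]] arrowD(1)[OF up[of "int (s + k)"]]]
    by (simp add: single_def)
  hence "int t dvd int k" by (simp add: cyclic_param_eq_iff[OF g] mod_eq_dvd_iff)
  moreover have "k dvd t"
  proof -
    have "g (int t) = g 0" by (simp add: cyclic_param_eq_iff[OF g])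
    hence "(g 0 + t) mod k = (g 0 + 0) mod k" using pos[of t] by simp
    hence "int k dvd int (g 0 + t) - int (g 0 + 0)" by (metis mod_eq_dvd_iff zmod_int)
    thus ?thesis by simp
  qed
  ultimately show ?thesis by (simp add: dvd_antisym)
qed

text \<open>Interior vertices of a segment have only one incoming arrow, so a cycle that climbs into
  the segment cannot turn before its end.\<close>

lemma ascend:
  assumes g: "cyclic_param edges (int t) g" "3 \<le> t" and up: "arrow (g 0) (g 1)"
    and p: "l dvd g 0 mod k" "g 0 mod k < (k div l) * l"
  shows "s \<le> l \<Longrightarrow> g (int s) mod k = (g 0 mod k + s) mod k \<and> vertex (g (int s))"
proof -
  let ?p = "g 0 mod k"
  have end_le: "?p + l \<le> (k div l) * l" using p by (rule segment_end_le)
  have main: "s < l \<Longrightarrow> g (int s) mod k = (?p + s) mod k \<and> arrow (g (int s)) (g (int s + 1))" for s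
  proof (induction s)
    case 0
    thus ?case using up by simp
  next
    case (Suc s)
    have IH: "g (int s) mod k = (?p + s) mod k" "arrow (g (int s)) (g (int s + 1))" using Suc by auto
    have pos: "g (int s + 1) mod k = (?p + Suc s) mod k"
      using arrowD(3)[OF IH(2)] IH(1) by (simp add: mod_Suc_eq)
    have "?p + Suc s < (k div l) * l" using end_le Suc(2) by simp
    moreover from this have "(?p + Suc s) mod k = ?p + Suc s"
      using segments_le by (intro mod_less) linarith
    moreover have "\<not> l dvd ?p + Suc s"
      using Suc(2) unfolding dvd_add_right_iff[OF p(1)] by (auto dest: dvd_imp_le)
    ultimately have ns: "\<not> single (g (int s + 1) mod k)" using pos by (simp add: single_def)
    have "g (int s + 1 + 1) \<noteq> g (int s)"
      using cyclic_param_eqD[OF g(1), of "int s + 1 + 1" "int s"] g(2) by auto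
    hence "\<not> arrow (g (int s + 1 + 1)) (g (int s + 1))"
      using arrow_source_unique[OF _ IH(2) ns] by blast
    hence "arrow (g (int s + 1)) (g (int s + 1 + 1))"
      using arrow_cases[OF cyclic_param_edge[OF g(1)]] by blast
    thus ?case using pos by (simp add: add.commute)
  qed
  show "g (int s) mod k = (?p + s) mod k \<and> vertex (g (int s))" if s: "s \<le> l"
  proof (cases s)
    case 0
    thus ?thesis using arrowD(1)[OF up] by simp
  next
    case (Suc r)
    hence "g (int r) mod k = (?p + r) mod k" "arrow (g (int r)) (g (int r + 1))"
      using main[of r] s by auto
    thus ?thesis using arrowD(2,3)[of "g (int r)" "g (int r + 1)"] Suc
      by (simp add: mod_Suc_eq add.commute)
  qed
qed

text \<open>A vertex with both cycle edges pointing upwards is the start of a segment. Both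
  directions then climb to the end of that segment, a single vertex \<open>l\<close> steps
  away.\<close>

lemma turning_cycle_length:
  assumes g: "cyclic_param edges (int t) g" "3 \<le> t"
    and up: "arrow (g 0) (g 1)" "arrow (g 0) (g (- 1))"
  shows "t = 2 * l"
proof -
  let ?p = "g 0 mod k"
  have ne: "g 1 \<noteq> g (- 1)" using cyclic_param_eqD[OF g(1), of 1 "- 1"] g(2) by auto
  have pos: "g 1 mod k = g (- 1) mod k" using up arrowD(3) by metis
  have ns: "\<not> single (g (- 1) mod k)"
    using ne single_vertex_eqI[OF arrowD(2)[OF up(1)] arrowD(2)[OF up(2)] pos] by blast
  have "single ?p"
  proof (rule ccontr)
    assume "\<not> single ?p"
    hence "g 1 div k = g (- 1) div k" using arrowD(4)[OF up(1)] arrowD(4)[OF up(2)] ns pos by metis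
    thus False using ne pos vertex_eqI by blast
  qed
  have p_lt: "?p < (k div l) * l"
  proof (rule ccontr)
    assume "\<not> ?thesis"
    hence "single (Suc ?p mod k)" by (auto simp: single_def mod_Suc)
    thus False using ns arrowD(3)[OF up(2)] by metis
  qed
  hence p_dvd: "l dvd ?p" using \<open>single ?p\<close> by (simp add: single_def)
  let ?h = "\<lambda>i. g (- i)"
  have h: "cyclic_param edges (int t) ?h" by (rule cyclic_param_reverse[OF g(1)])
  have g_pos: "g (int s) mod k = (?p + s) mod k \<and> vertex (g (int s))" if "s \<le> l" for s
    using ascend[OF g up(1) p_dvd p_lt that] .
  have h_pos: "g (- int l) mod k = (?p + l) mod k \<and> vertex (g (- int l))"
    using ascend[OF h g(2), of l] up(2) p_dvd p_lt by simp
  have "single ((?p + l) mod k)"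
  proof (cases "?p + l < k")
    case True
    thus ?thesis using p_dvd by (simp add: single_def)
  next
    case False
    have "?p + l \<le> (k div l) * l" using p_dvd p_lt by (rule segment_end_le)
    hence "?p + l = k" using False segments_le by linarith
    thus ?thesis by (simp add: single_def)
  qed
  hence "g (int l) = g (- int l)" using single_vertex_eqI g_pos[of l] h_pos by simp
  hence "int t dvd int (2 * l)" by (simp add: cyclic_param_eq_iff[OF g(1)] mod_eq_dvd_iff)
  hence "t dvd 2 * l" by presburger
  then obtain r where r: "2 * l = t * r" by (elim dvdE)
  \<comment> \<open>Positions do not repeat within \<open>l < k\<close> steps; with \<open>t\<close>
    dividing \<open>2 * l\<close> this leaves only \<open>r = 1\<close>.\<close>
  have "l < t"
  proof (rule ccontr)
    assume "\<not> l < t"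
    hence t: "t \<le> l" by simp
    have "g (int t) = g 0" by (simp add: cyclic_param_eq_iff[OF g(1)])
    hence "(?p + t) mod k = ?p mod k" using g_pos[OF t] by simp
    hence "int k dvd int (?p + t) - int ?p" by (metis mod_eq_dvd_iff zmod_int)
    hence "k dvd t" by simp
    thus False using t g(2) k_pos(3) by (auto dest: dvd_imp_le)
  qed
  have "r < 2"
  proof (rule ccontr)
    assume "\<not> r < 2"
    hence "t * 2 \<le> t * r" by simp
    thus False using r \<open>l < t\<close> by linarith
  qed
  moreover have "r \<noteq> 0" using r l_ge by (intro notI) simp
  ultimately have "r = 1" by simp
  thus ?thesis using r by simp
qed

lemma cycle_length:
  assumes "C \<in> cycles edges"
  shows "card C = k \<or> card C = 2 * l"
proof -
  let ?t = "card C"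
  obtain g where g: "cyclic_param edges (int ?t) g" "3 \<le> ?t"
    using assms by (rule cycles_cyclic_param)
  define up where "up i \<longleftrightarrow> arrow (g i) (g (i + 1))" for i
  have down: "arrow (g (i + 1)) (g i)" if "\<not> up i" for i
    using arrow_cases[OF cyclic_param_edge[OF g(1)]] that by (auto simp: up_def)
  have up_mod: "up i = up j" if "i mod int ?t = j mod int ?t" for i j
  proof -
    have "(i + 1) mod int ?t = (j + 1) mod int ?t" using that by (rule mod_add_cong) simp
    hence "g i = g j" "g (i + 1) = g (j + 1)" using that by (simp_all add: cyclic_param_eq_iff[OF g(1)])
    thus ?thesis by (simp add: up_def)
  qed
  consider "\<forall>i. up i" | "\<forall>i. \<not> up i" | i where "up i" "\<not> up (i - 1)"
  proof (cases "\<exists>i. up i \<and> \<not> up (i - 1)")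
    case False
    \<comment> \<open>Without a turn, upward edges are preceded by upward edges only, and
      periodicity carries this to every position.\<close>
    hence prev: "up (i - 1)" if "up i" for i using that by blast
    have "up i" if "up j" for i j
    proof -
      have "up (j - int s)" for s
      proof (induction s)
        case (Suc s)
        thus ?case using prev[of "j - int s"] by (simp add: algebra_simps)
      qed (use that in simp)
      hence "up (j - (j - i) mod int ?t)" using g(2) by (metis nat_0_le pos_mod_sign of_nat_0_less_iff
            gr0I not_numeral_le_zero)
      thus ?thesis using up_mod[of "j - (j - i) mod int ?t" i] by (simp add: mod_simps)
    qed
    thus thesis using that by blast
  qed (use that in blast)
  thus ?thesis
  proof cases
    case 1
    thus ?thesis using monotone_cycle_length[OF g(1)] by (simp add: up_def)
  next
    case 2
    have "arrow (g (- i)) (g (- (i + 1)))" for i using down[of "- i - 1"] 2 by simp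
    thus ?thesis using monotone_cycle_length[OF cyclic_param_reverse[OF g(1)]] by simp
  next
    case (3 i)
    have "arrow (g i) (g (i - 1))" using down[OF 3(2)] by simp
    thus ?thesis
      using turning_cycle_length[OF cyclic_param_shift[OF g(1), of i] g(2)] 3(1)
      by (simp add: up_def)
  qed
qed

section \<open>Counting cycles by choices of parallel paths\<close>

text \<open>\<open>c j\<close> is the number of the path chosen in segment \<open>j\<close>.\<close>

definition copy :: "(nat \<Rightarrow> nat) \<Rightarrow> nat \<Rightarrow> nat" where
  "copy c p = p + k * (if single p then 0 else c (p div l))"

lemma copy_mod: "p < k \<Longrightarrow> copy c p mod k = p"
  by (simp add: copy_def)

lemma copy_div: "p < k \<Longrightarrow> copy c p div k = (if single p then 0 else c (p div l))"
  by (simp add: copy_def)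

lemma vertex_copy:
  assumes "c \<in> {..<k div l} \<rightarrow> {..<M}" "p < k"
  shows "vertex (copy c p)"
proof -
  let ?j = "if single p then 0 else c (p div l)"
  have "?j < M"
  proof (cases "single p")
    case False
    hence "p div l < k div l" using l_ge by (simp add: single_def div_less_iff_less_mult)
    thus ?thesis using assms(1) False by auto
  qed (use M_pos in simp)
  hence "k * Suc ?j \<le> k * M" by (intro mult_le_mono2) simp
  hence "copy c p < k * M" using assms(2) by (simp add: copy_def)
  thus ?thesis using copy_mod[OF assms(2), of c] copy_div[OF assms(2), of c] by (simp add: vertex_def)
qed

lemma copy_cycle:
  assumes "c \<in> {..<k div l} \<rightarrow> {..<M}"
  shows "closed_walk_edges (map (copy c) [0..<k]) \<in> cycles edges"
proof -
  have "arrow (copy c p) (copy c (Suc p mod k))" if p: "p < k" for p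
  proof -
    have p': "Suc p mod k < k" using k_pos by simp
    \<comment> \<open>A position that is not a multiple of \<open>l\<close> lies in the same segment
      as its predecessor.\<close>
    have "c (p div l) = c (Suc p mod k div l)" if "\<not> single (Suc p mod k)"
    proof -
      have "Suc p \<noteq> k" using that by (auto simp: single_def)
      hence "Suc p mod k = Suc p" using p by simp
      moreover from this have "\<not> l dvd Suc p" using that by (simp add: single_def)
      ultimately show ?thesis by (simp add: div_Suc dvd_eq_mod_eq_0)
    qed
    thus ?thesis
      using vertex_copy[OF assms p] vertex_copy[OF assms p'] copy_mod[OF p] copy_mod[OF p']
        copy_div[OF p] copy_div[OF p'] by (simp add: arrow_def)
  qed
  hence "closed_walk_edges (map (copy c) [0..<k]) \<subseteq> edges"
    using k_pos by (auto simp: closed_walk_edges_def edges_def)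
  moreover have "inj_on (copy c) {0..<k}"
    by (rule inj_on_inverseI[where g = "\<lambda>v. v mod k"]) (simp add: copy_mod)
  hence "distinct (map (copy c) [0..<k])" by (simp add: distinct_map)
  moreover have "3 \<le> length (map (copy c) [0..<k])" using l_ge k_ge by simp
  ultimately show ?thesis unfolding cycles_def by blast
qed

text \<open>The choice \<open>c\<close> can be read off the vertices of its cycle, at the first
  interior position \<open>i * l + 1\<close> of each segment \<open>i\<close>.\<close>

lemma card_cycles_ge: "M ^ (k div l) \<le> card (cycles edges)"
proof -
  let ?P = "{..<k div l} \<rightarrow>\<^sub>E {..<M}"
  let ?cyc = "\<lambda>c. closed_walk_edges (map (copy c) [0..<k])"
  have "inj_on ?cyc ?P"
  proof (rule inj_onI)
    fix c c' assume c: "c \<in> ?P" "c' \<in> ?P" "?cyc c = ?cyc c'"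
    have "set (map (copy c) [0..<k]) = set (map (copy c') [0..<k])"
      using Union_closed_walk_edges[of "map (copy c) [0..<k]"]
        Union_closed_walk_edges[of "map (copy c') [0..<k]"] c(3) k_pos by auto
    hence sets: "copy c ` {0..<k} = copy c' ` {0..<k}" by simp
    show "c = c'"
    proof (rule PiE_ext[OF c(1,2)])
      fix i assume "i \<in> {..<k div l}"
      hence "Suc i * l \<le> (k div l) * l" by (intro mult_le_mono1) simp
      hence p1: "i * l + 1 < (k div l) * l" using l_ge by simp
      have p: "i * l + 1 < (k div l) * l" "i * l + 1 < k"
        using p1 less_le_trans[OF p1 segments_le] by auto
      have "\<not> l dvd i * l + 1" unfolding dvd_add_right_iff[OF dvd_triv_right] using l_ge by simp
      hence ns: "\<not> single (i * l + 1)" using p(1) by (simp add: single_def)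
      have "copy c (i * l + 1) \<in> copy c' ` {0..<k}" using sets p(2) by auto
      then obtain p' where "p' < k" "copy c (i * l + 1) = copy c' p'" by auto
      hence "copy c (i * l + 1) = copy c' (i * l + 1)" using copy_mod p(2) by metis
      moreover have "(i * l + 1) div l = i + 1 div l" using l_ge by (intro div_mult_self3) simp
      hence "(i * l + 1) div l = i" using l_ge by simp
      ultimately show "c i = c' i" using ns k_pos by (simp add: copy_def)
    qed
  qed
  moreover have "?cyc ` ?P \<subseteq> cycles edges" using copy_cycle by (auto simp: PiE_def)
  moreover have "finite (cycles edges)"
    using simple_graph_edges[OF order_refl] finite_edges finite_cycles by blast
  ultimately have "card ?P \<le> card (cycles edges)" by (intro card_inj_on_le)
  thus ?thesis by (simp add: card_PiE)
qed

end

text \<open>With \<open>n div k\<close> copies the extremal graph fits into \<open>{..<n}\<close>;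
  the remaining vertices are isolated.\<close>

lemma max_cycles_ge:
  assumes "2 \<le> l" "2 * l \<le> k" "k \<in> L" "2 * l \<in> L" "k \<le> n"
  shows "(n div k) ^ (k div l) \<le> max_cycles L n"
proof -
  have "0 < n div k" using assms by (simp add: div_greater_zero_iff)
  then interpret theta_cycle k l "n div k" using assms by unfold_locales
  have "L_cycle_graph L {..<n} edges"
    unfolding L_cycle_graph_def using simple_graph_edges[of n] cycle_length assms(3,4) by fastforce
  hence "card (cycles edges) \<le> max_cycles L n"
    unfolding max_cycles_def by (intro Max_ge max_cycles_range_finite) auto
  thus ?thesis using card_cycles_ge by (rule order_trans[rotated])
qed

theorem theorem3:
  fixes L :: "nat set" and k l :: nat
  assumes "finite L" and "\<forall>m\<in>L. 3 \<le> m" and "\<exists>m\<in>L. even m"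
    and "2 * l = Min {m \<in> L. even m}" and "k = Max L"
  shows "\<exists>C1 C2 :: real. \<exists>n0 :: nat. C1 > 0 \<and> C2 > 0 \<and>
    (\<forall>n\<ge>n0. C1 * real n ^ (k div l) \<le> real (max_cycles L n) \<and>
             real (max_cycles L n) \<le> C2 * real n ^ (k div l))"
proof -
  let ?q = "k div l"
  let ?K = "\<Sum>m\<in>L. homogenization_const m (m * (2 * k + 10))"
  have fin: "finite {m \<in> L. even m}" using assms(1) by simp
  have "{m \<in> L. even m} \<noteq> {}" using assms(3) by blast
  from Min_in[OF fin this] have l_in: "2 * l \<in> L" unfolding assms(4)[symmetric] by blast
  have l_min: "\<forall>m\<in>L. even m \<longrightarrow> 2 * l \<le> m" unfolding assms(4) using fin by simp
  have k_in: "k \<in> L" unfolding assms(5) using assms(1) l_in by (intro Max_in) auto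
  have k_max: "\<forall>m\<in>L. m \<le> k" unfolding assms(5) using assms(1) by simp
  have "3 \<le> 2 * l" using assms(2) l_in by blast
  hence l: "2 \<le> l" by simp
  have kl: "2 * l \<le> k" using k_max l_in by blast
  \<comment> \<open>For \<open>n \<ge> k\<close> one has \<open>n div k \<ge> n / (2 * k)\<close>,
    so \<open>k\<close> serves as threshold. The summand 1 in \<open>C2\<close> makes its positivity
    immediate.\<close>
  define C1 where "C1 = (1 / (2 * real k)) ^ ?q"
  define C2 where "C2 = real ?K + 1"
  have "C1 * real n ^ ?q \<le> real (max_cycles L n) \<and> real (max_cycles L n) \<le> C2 * real n ^ ?q"
    if n: "k \<le> n" for n
  proof
    have k_pos: "0 < k" using l kl by simp
    have "1 \<le> n div k" using n k_pos by (simp add: Suc_le_eq div_greater_zero_iff)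
    hence "k * 1 \<le> k * (n div k)" by (rule mult_le_mono2)
    moreover have "n = k * (n div k) + n mod k" by simp
    moreover have "n mod k < k" using k_pos by simp
    ultimately have "n \<le> 2 * (k * (n div k))" by linarith
    hence "real n \<le> real (2 * (k * (n div k)))" by (rule of_nat_mono)
    hence "real n / (2 * real k) \<le> real (n div k)" using k_pos by (simp add: field_simps)
    hence "(real n / (2 * real k)) ^ ?q \<le> real (n div k) ^ ?q" by (intro power_mono) auto
    also have "\<dots> \<le> real (max_cycles L n)"
      unfolding of_nat_power[symmetric] of_nat_le_iff by (rule max_cycles_ge[OF l kl k_in l_in n])
    finally show "C1 * real n ^ ?q \<le> real (max_cycles L n)"
      by (simp add: C1_def power_mult_distrib[symmetric])
    have "max_cycles L n \<le> ?K * n ^ ?q"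
      using l k_pos n by (intro max_cycles_le assms(1,2) k_max l_min kl) auto
    hence "real (max_cycles L n) \<le> real (?K * n ^ ?q)" by (rule of_nat_mono)
    also have "\<dots> = real ?K * real n ^ ?q" by (simp only: of_nat_mult of_nat_power)
    also have "\<dots> \<le> C2 * real n ^ ?q" unfolding C2_def by (intro mult_right_mono) auto
    finally show "real (max_cycles L n) \<le> C2 * real n ^ ?q" .
  qed
  moreover have "0 < C1" using l kl by (simp add: C1_def)
  moreover have "0 < C2" unfolding C2_def by (meson add_nonneg_pos of_nat_0_le_iff zero_less_one)
  ultimately show ?thesis by blast
qed

end
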